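(* Let $m\ge 3$ and $n\ge 1$ be integers and let $t=m-1$. For every integer $N\ge 0$ let $b_{m,N}$ denote the number of random walk labelings of $S_{m,N}$ that start (i.e. assign label $1$) at one fixed end of the underlying path graph. Then $b_{m,N}$ is recursively given by $$b_{m,N} = \begin{cases} 1,&N=0;\\ 2^{m-2},&N=1;\\ b_{m, N-1}\left(1+\sum_{j=2}^t\binom{Nt+1-j}{m-j}2^{t-j}\right),& N>1, \end{cases}$$ and \begin{align*} \mathcal{L}(S_{m,n})&=\sum_{k=0}^{n-1}\sum_{j=2}^t\sum_{r=0}^{t-j-1}\sum_{s=0}^{kt}\binom{r+s}{s}\binom{nt-s-j-r}{kt-s,\;t-j-r,\;(n-1-k)t}2^{t-r-2}\,b_{m,k}\,b_{m,n-1-k}\\ &\quad+\sum_{k=0}^{n-1}\sum_{j=2}^t2^{j-1}\sum_{s=0}^{kt}\binom{t-j+s}{s}\binom{(n-1)t-s}{kt-s}\,b_{m,k}\,b_{m,n-1-k}\\ &\quad+\sum_{k=0}^{n}\binom{nt}{kt}\,b_{m,k}\,b_{m,n-k}. \end{align*}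
   Context: Let $H$ be a finite, connected, undirected graph with vertex set $V$. A random walk labeling of $H$ is a labeling of $V$ obtainable by the following process: (1) set $i=1$, choose any $v\in V$ and label $v$ with $i$; (2) as long as there are unlabeled vertices, choose a vertex $w$ adjacent to the current vertex $v$ and replace $v$ by $w$; if this new $v$ is not labeled, increase $i$ by $1$ and label $v$ with $i$. The number of different random walk labelings of $H$ is denoted by $\mathcal{L}(H)$. The graph $S_{m,n}$ is defined as follows: begin with a path graph $P_{n+1}$ on $n+1$ vertices and replace each edge of the path with an edge of a cycle graph $C_m$. That is, for each of the $n$ edges $uv$ of the path, $m-2$ new vertices are added which together with $u,v$ form a cycle of length $m$ having $uv$ as one of its edges; the new vertices of different cycles are distinct. Thus $S_{m,n}$ has $n(m-1)+1$ vertices, and $S_{m,0}$ is a single vertex. The ends of the path graph are the two end vertices of $P_{n+1}$ (a single vertex if $n=0$); by symmetry the number of random walk labelings starting at a given end does not depend on which end is chosen. $\binom{N}{a,b,c}=\frac{N!}{a!\,b!\,c!}$ with $a+b+c=N$ is the multinomial coefficient. Empty sums are $0$. *)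

theory Defs
  imports Complex_Main
begin

text \<open>
  An undirected graph is given by a vertex set \<open>V\<close> and a set \<open>E\<close> of two-element subsets of \<open>V\<close>.
  \<open>walk_state V E v i lab\<close>: the process can reach a situation with current vertex \<open>v\<close>, counter \<open>i\<close>
  and partial labeling \<open>lab\<close>, where \<open>None\<close> means unlabeled.
\<close>

inductive walk_state :: "'a set \<Rightarrow> 'a set set \<Rightarrow> 'a \<Rightarrow> nat \<Rightarrow> ('a \<rightharpoonup> nat) \<Rightarrow> bool"
  for V E where
  start: "v \<in> V \<Longrightarrow> walk_state V E v 1 [v \<mapsto> 1]"
| visit_new: "walk_state V E v i lab \<Longrightarrow> dom lab \<noteq> V \<Longrightarrow> w \<in> V \<Longrightarrow> {v, w} \<in> E \<Longrightarrow> lab w = None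
    \<Longrightarrow> walk_state V E w (i + 1) (lab(w \<mapsto> i + 1))"
| visit_old: "walk_state V E v i lab \<Longrightarrow> dom lab \<noteq> V \<Longrightarrow> w \<in> V \<Longrightarrow> {v, w} \<in> E \<Longrightarrow> lab w \<noteq> None
    \<Longrightarrow> walk_state V E w i lab"

definition random_walk_labelings :: "'a set \<Rightarrow> 'a set set \<Rightarrow> ('a \<rightharpoonup> nat) set" where
  "random_walk_labelings V E = {lab. dom lab = V \<and> (\<exists>v i. walk_state V E v i lab)}"

definition num_labelings :: "'a set \<Rightarrow> 'a set set \<Rightarrow> nat" where
  "num_labelings V E = card (random_walk_labelings V E)"

definition num_labelings_from :: "'a set \<Rightarrow> 'a set set \<Rightarrow> 'a \<Rightarrow> nat" where
  "num_labelings_from V E v = card {lab \<in> random_walk_labelings V E. lab v = Some 1}"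

text \<open>
  \<open>Path k\<close> is the \<open>k\<close>-th vertex of the path (\<open>k = 0, \<dots>, n\<close>), and \<open>New k l\<close> is the \<open>l\<close>-th vertex
  (\<open>l = 0, \<dots>, m - 3\<close>) added for the path edge between \<open>Path k\<close> and \<open>Path (Suc k)\<close>.
\<close>

datatype vertex = Path nat | New nat nat

definition cycle_edges :: "'a list \<Rightarrow> 'a set set" where
  "cycle_edges xs = {{xs ! i, xs ! (Suc i mod length xs)} |i. i < length xs}"

text \<open>The path edge between \<open>Path k\<close> and \<open>Path (Suc k)\<close> is the closing edge of the cycle.\<close>

definition cycle_vertices :: "nat \<Rightarrow> nat \<Rightarrow> vertex list" where
  "cycle_vertices m k = Path k # map (New k) [0..<m - 2] @ [Path (Suc k)]"

definition S_verts :: "nat \<Rightarrow> nat \<Rightarrow> vertex set" where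
  "S_verts m n = Path ` {..n} \<union> {New k l |k l. k < n \<and> l < m - 2}"

definition S_edges :: "nat \<Rightarrow> nat \<Rightarrow> vertex set set" where
  "S_edges m n = (\<Union>k<n. cycle_edges (cycle_vertices m k))"

definition path_ends :: "nat \<Rightarrow> vertex set" where
  "path_ends n = {Path 0, Path n}"

text \<open>Only used with \<open>a + b + c = N\<close>, when the division is exact.\<close>

definition multinomial :: "nat \<Rightarrow> nat \<Rightarrow> nat \<Rightarrow> nat \<Rightarrow> nat" where
  "multinomial N a b c = fact N div (fact a * fact b * fact c)"

lemma length_cycle_vertices: "2 \<le> m \<Longrightarrow> length (cycle_vertices m k) = m"
  by (simp add: cycle_vertices_def)

lemma distinct_cycle_vertices: "distinct (cycle_vertices m k)"
  by (auto simp: cycle_vertices_def distinct_map inj_on_def)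

lemma path_edge_in_S_edges:
  assumes "k < n"
  shows "{Path k, Path (Suc k)} \<in> S_edges m n"
proof -
  let ?xs = "cycle_vertices m k"
  have "?xs ! (m - 2 + 1) = Path (Suc k)" "?xs ! 0 = Path k" "length ?xs = m - 2 + 2"
    by (simp_all add: cycle_vertices_def nth_append)
  then have "{Path (Suc k), Path k} \<in> cycle_edges ?xs"
    unfolding cycle_edges_def by (intro CollectI exI[of _ "m - 2 + 1"]) simp
  then show ?thesis
    using assms by (auto simp: S_edges_def insert_commute)
qed

lemma S_edges_subset_S_verts:
  assumes "e \<in> S_edges m n"
  shows "e \<subseteq> S_verts m n \<and> card e = 2"
proof -
  obtain k i where k: "k < n" and i: "i < length (cycle_vertices m k)"
    and e: "e = {cycle_vertices m k ! i, cycle_vertices m k ! (Suc i mod length (cycle_vertices m k))}"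
    using assms by (auto simp: S_edges_def cycle_edges_def)
  define xs where "xs = cycle_vertices m k"
  have len: "length xs \<ge> 2"
    by (simp add: xs_def cycle_vertices_def)
  then have j: "Suc i mod length xs < length xs"
    by (intro mod_less_divisor) linarith
  have ne: "Suc i mod length xs \<noteq> i"
    using len i by (cases "Suc i = length xs") (auto simp: xs_def)
  have "set xs \<subseteq> S_verts m n"
    using k by (auto simp: xs_def cycle_vertices_def S_verts_def)
  moreover have "xs ! i \<noteq> xs ! (Suc i mod length xs)"
    using distinct_cycle_vertices[of m k] i j ne by (simp add: xs_def nth_eq_iff_index_eq)
  ultimately show ?thesis
    using e i j nth_mem[of i xs] nth_mem[OF j] by (auto simp: xs_def)
qed

lemma card_S_verts:
  assumes "2 \<le> m"
  shows "finite (S_verts m n)" "card (S_verts m n) = n * (m - 1) + 1"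
proof -
  have eq: "{New k l |k l. k < n \<and> l < m - 2} = (\<lambda>(k, l). New k l) ` ({..<n} \<times> {..<m - 2})"
    by auto
  show "finite (S_verts m n)"
    unfolding S_verts_def eq by simp
  have "card (S_verts m n) = Suc n + n * (m - 2)"
    unfolding S_verts_def eq
    by (subst card_Un_disjoint) (auto simp: card_image inj_on_def)
  moreover have "m - 1 = Suc (m - 2)"
    using assms by simp
  ultimately show "card (S_verts m n) = n * (m - 1) + 1"
    by simp
qed

end

theory Submission
  imports Defs
begin

text \<open>
  A walk can move freely inside the labeled set, so a random walk labeling is an order of the vertices in
  which every vertex after the first is adjacent to an earlier one. Parts of the unlabeled set that are
  not joined by an edge are filled independently, which gives binomial coefficients, and a gap of \<open>g\<close>
  vertices between labeled ends is filled in \<open>2 ^ (g - 1)\<close> orders.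

  From a path vertex the labeling splits into the two chains at its sides. From an inner vertex of a
  cycle the labeled arc grows until it reaches a path vertex; the left chain is then independent of the
  rest. This yields the claimed sums with \<open>s\<close> summed out by
  \<open>(\<Sum>s\<le>a. (r + s choose s) * (q + a - s choose (a - s))) = (r + q + 1 + a choose a)\<close>;
  reaching the right path vertex first is the mirror image, which doubles the count.
\<close>

subsection \<open>Orders in which a connected set grows\<close>

fun grows :: "('a \<Rightarrow> 'a \<Rightarrow> bool) \<Rightarrow> 'a set \<Rightarrow> 'a list \<Rightarrow> bool" where
  "grows R S [] = True"
| "grows R S (x # xs) = ((\<exists>u\<in>S. R u x) \<and> grows R (insert x S) xs)"

text \<open>\<open>S\<close> holds the labeled vertices and \<open>A\<close> those to come. Their
  union may be a part of the graph only, so independent parts of the unlabeled set can be counted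
  separately.\<close>

definition growths :: "('a \<Rightarrow> 'a \<Rightarrow> bool) \<Rightarrow> 'a set \<Rightarrow> 'a set \<Rightarrow> 'a list set" where
  "growths R S A = {xs. distinct xs \<and> set xs = A \<and> grows R S xs}"

definition num_growths :: "('a \<Rightarrow> 'a \<Rightarrow> bool) \<Rightarrow> 'a set \<Rightarrow> 'a set \<Rightarrow> nat" where
  "num_growths R S A = card (growths R S A)"

lemma grows_snoc: "grows R S (xs @ [x]) \<longleftrightarrow> grows R S xs \<and> (\<exists>u\<in>S \<union> set xs. R u x)"
  by (induction xs arbitrary: S) auto

lemma finite_growths: "finite A \<Longrightarrow> finite (growths R S A)"
  by (rule finite_subset[OF _ finite_subset_distinct[of A]]) (auto simp: growths_def)

lemma num_growths_empty [simp]: "num_growths R S {} = 1"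
proof -
  have "growths R S {} = {[]}" by (auto simp: growths_def)
  then show ?thesis by (simp add: num_growths_def)
qed

lemma num_growths_rec:
  assumes "finite A" "A \<noteq> {}"
  shows "num_growths R S A = (\<Sum>w | w \<in> A \<and> (\<exists>u\<in>S. R u w). num_growths R (insert w S) (A - {w}))"
proof -
  let ?W = "{w. w \<in> A \<and> (\<exists>u\<in>S. R u w)}"
  have eq: "growths R S A = (\<Union>w\<in>?W. (#) w ` growths R (insert w S) (A - {w}))" (is "_ = ?U")
  proof (intro set_eqI iffI)
    fix xs assume "xs \<in> growths R S A"
    then show "xs \<in> ?U"
      using assms by (cases xs) (auto simp: growths_def)
  next
    fix xs assume "xs \<in> ?U"
    then obtain w ys where "w \<in> ?W" "ys \<in> growths R (insert w S) (A - {w})" "xs = w # ys"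
      by blast
    then show "xs \<in> growths R S A"
      by (simp add: growths_def insert_absorb)
  qed
  have "card ?U = (\<Sum>w\<in>?W. card ((#) w ` growths R (insert w S) (A - {w})))"
  proof (rule card_UN_disjoint)
    show "\<forall>w\<in>?W. finite ((#) w ` growths R (insert w S) (A - {w}))"
      using assms by (simp add: finite_growths)
  qed (use assms in auto)
  then show ?thesis
    unfolding num_growths_def eq by (simp add: card_image)
qed

text \<open>\<open>S\<close> matters only through the vertices of \<open>A\<close> that it reaches,
  so vertices labeled in one part can be forgotten when another part is counted.\<close>

lemma num_growths_local:
  assumes "finite A" "\<And>a. a \<in> A \<Longrightarrow> (\<exists>u\<in>S. R u a) \<longleftrightarrow> (\<exists>u\<in>S'. R u a)"
  shows "num_growths R S A = num_growths R S' A"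
  using assms
proof (induction "card A" arbitrary: A S S')
  case 0
  then show ?case by simp
next
  case (Suc c)
  then have ne: "A \<noteq> {}" by auto
  have "num_growths R (insert w S) (A - {w}) = num_growths R (insert w S') (A - {w})" if "w \<in> A" for w
    using Suc that by (intro Suc.hyps(1)) (auto 0 3)
  moreover have "{w. w \<in> A \<and> (\<exists>u\<in>S. R u w)} = {w. w \<in> A \<and> (\<exists>u\<in>S'. R u w)}"
    using Suc.prems(2) by auto
  ultimately show ?case
    using Suc.prems(1) ne by (auto simp: num_growths_rec intro!: sum.cong)
qed

text \<open>The orders of the union are the shuffles of an order of \<open>A\<close> with an order
  of \<open>B\<close>. The proof avoids shuffles: it removes the first vertex, which lies in one of
  the two parts, and applies induction.\<close>

lemma num_growths_Un:
  assumes "finite A" "finite B" "A \<inter> B = {}"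
    and "\<And>a b. a \<in> A \<Longrightarrow> b \<in> B \<Longrightarrow> \<not> R a b \<and> \<not> R b a"
  shows "num_growths R S (A \<union> B) =
    (card A + card B choose card A) * num_growths R S A * num_growths R S B"
  using assms
proof (induction "card A + card B" arbitrary: A B S rule: less_induct)
  case less
  show ?case
  proof (cases "A = {} \<or> B = {}")
    case True
    then show ?thesis by auto
  next
    case False
    then obtain a b where ab: "card A = Suc a" "card B = Suc b"
      using less.prems by (metis card_eq_0_iff not0_implies_Suc)
    let ?W = "\<lambda>A. {w. w \<in> A \<and> (\<exists>u\<in>S. R u w)}"
    have W: "?W (A \<union> B) = ?W A \<union> ?W B" "?W A \<inter> ?W B = {}" "finite (?W A)" "finite (?W B)"
      using less.prems by auto
    have 1: "num_growths R (insert w S) (A \<union> B - {w}) =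
      (a + Suc b choose a) * num_growths R (insert w S) (A - {w}) * num_growths R S B"
      if "w \<in> ?W A" for w
    proof -
      have "A \<union> B - {w} = (A - {w}) \<union> B" using that less.prems by auto
      moreover have "num_growths R (insert w S) ((A - {w}) \<union> B) =
          (a + Suc b choose a) * num_growths R (insert w S) (A - {w}) * num_growths R (insert w S) B"
        using less.hyps[of "A - {w}" B "insert w S"] that less.prems ab by auto
      \<comment> \<open>\<open>w\<close> lies in \<open>A\<close>, so labeling it makes no further
        vertex of \<open>B\<close> reachable.\<close>
      moreover have "num_growths R (insert w S) B = num_growths R S B"
        using that less.prems by (intro num_growths_local) auto
      ultimately show ?thesis by simp
    qed
    have 2: "num_growths R (insert w S) (A \<union> B - {w}) =
      (Suc a + b choose Suc a) * num_growths R S A * num_growths R (insert w S) (B - {w})"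
      if "w \<in> ?W B" for w
    proof -
      have "A \<union> B - {w} = A \<union> (B - {w})" using that less.prems by auto
      moreover have "num_growths R (insert w S) (A \<union> (B - {w})) =
          (Suc a + b choose Suc a) * num_growths R (insert w S) A * num_growths R (insert w S) (B - {w})"
        using less.hyps[of A "B - {w}" "insert w S"] that less.prems ab by auto
      moreover have "num_growths R (insert w S) A = num_growths R S A"
        using that less.prems by (intro num_growths_local) auto
      ultimately show ?thesis by simp
    qed
    have "num_growths R S (A \<union> B) =
      (\<Sum>w\<in>?W A. num_growths R (insert w S) (A \<union> B - {w})) +
      (\<Sum>w\<in>?W B. num_growths R (insert w S) (A \<union> B - {w}))"
      using less.prems False W by (simp add: num_growths_rec sum.union_disjoint del: Un_iff)
    also have "\<dots> = (a + Suc b choose a) * num_growths R S A * num_growths R S B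
      + (Suc a + b choose Suc a) * num_growths R S A * num_growths R S B"
    proof -
      have rec: "num_growths R S A = (\<Sum>w\<in>?W A. num_growths R (insert w S) (A - {w}))"
        "num_growths R S B = (\<Sum>w\<in>?W B. num_growths R (insert w S) (B - {w}))"
        using less.prems False by (auto simp: num_growths_rec)
      have "(\<Sum>w\<in>?W A. num_growths R (insert w S) (A \<union> B - {w})) =
          (a + Suc b choose a) * num_growths R S A * num_growths R S B"
        unfolding rec(1) by (simp only: 1 sum_distrib_left sum_distrib_right cong: sum.cong)
      moreover have "(\<Sum>w\<in>?W B. num_growths R (insert w S) (A \<union> B - {w})) =
          (Suc a + b choose Suc a) * num_growths R S A * num_growths R S B"
        unfolding rec(2) by (simp only: 2 sum_distrib_left cong: sum.cong)
      ultimately show ?thesis by simp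
    qed
    \<comment> \<open>The two binomial coefficients add up by Pascal's rule.\<close>
    finally show ?thesis
      by (simp add: ab algebra_simps)
  qed
qed

text \<open>Both sides satisfy the same recursion over the first vertex. This serves the reflection
  of chains and the passage from graph vertices to integers.\<close>

lemma num_growths_image:
  assumes "finite A" "inj_on f A" "\<And>u a. u \<in> S \<union> A \<Longrightarrow> a \<in> A \<Longrightarrow> R' (f u) (f a) \<longleftrightarrow> R u a"
  shows "num_growths R' (f ` S) (f ` A) = num_growths R S A"
  using assms
proof (induction "card A" arbitrary: A S)
  case 0
  then show ?case by simp
next
  case (Suc c)
  then have ne: "A \<noteq> {}" by auto
  let ?W = "{w. w \<in> A \<and> (\<exists>u\<in>S. R u w)}"
  have step: "num_growths R' (insert (f w) (f ` S)) (f ` A - {f w}) = num_growths R (insert w S) (A - {w})"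
    if "w \<in> A" for w
  proof -
    have "f ` A - {f w} = f ` (A - {w})"
      using Suc.prems(2) that by (auto simp: inj_on_def)
    moreover have "num_growths R' (f ` insert w S) (f ` (A - {w})) = num_growths R (insert w S) (A - {w})"
      using Suc that by (intro Suc.hyps(1)) (auto intro: inj_on_diff)
    ultimately show ?thesis by simp
  qed
  have "{w. w \<in> f ` A \<and> (\<exists>u\<in>f ` S. R' u w)} = f ` ?W"
    using Suc.prems(3) by auto
  moreover have "inj_on f ?W" using Suc.prems(2) by (auto simp: inj_on_def)
  ultimately have "num_growths R' (f ` S) (f ` A) = (\<Sum>w\<in>?W. num_growths R' (insert (f w) (f ` S)) (f ` A - {f w}))"
    using Suc.prems(1) ne by (simp add: num_growths_rec[of "f ` A"] sum.reindex)
  also have "\<dots> = num_growths R S A"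
    using Suc.prems(1) ne step by (simp add: num_growths_rec[of A])
  finally show ?case .
qed

subsection \<open>Labelings\<close>

definition lab_of :: "'a list \<Rightarrow> 'a \<rightharpoonup> nat" where
  "lab_of xs = map_of (zip xs [1..<Suc (length xs)])"

lemma dom_lab_of [simp]: "dom (lab_of xs) = set xs"
  by (simp add: lab_of_def dom_map_of_zip del: upt_Suc)

lemma lab_of_snoc: "x \<notin> set xs \<Longrightarrow> lab_of (xs @ [x]) = (lab_of xs)(x \<mapsto> length xs + 1)"
proof -
  have "[1..<Suc (length (xs @ [x]))] = [1..<Suc (length xs)] @ [Suc (length xs)]" by simp
  then have "lab_of (xs @ [x]) = [x \<mapsto> Suc (length xs)] ++ lab_of xs"
    by (simp add: lab_of_def del: upt_Suc)
  moreover assume "x \<notin> set xs"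
  ultimately show ?thesis
    by (auto simp: fun_eq_iff map_add_def domIff simp flip: dom_lab_of split: option.split)
qed

lemma lab_of_singleton: "lab_of [x] = [x \<mapsto> 1]"
  by (simp add: lab_of_def)

lemma lab_of_nth: "distinct xs \<Longrightarrow> i < length xs \<Longrightarrow> lab_of xs (xs ! i) = Some (Suc i)"
  by (simp add: lab_of_def map_of_zip_nth del: upt_Suc)

text \<open>A label is a position in the list, so equal labelings put the same vertex at every
  position.\<close>

lemma lab_of_inj:
  assumes "distinct xs" "distinct ys" "lab_of xs = lab_of ys"
  shows "xs = ys"
proof (rule nth_equalityI)
  have s: "set xs = set ys" using assms(3) by (metis dom_lab_of)
  then show "length xs = length ys" using assms by (metis distinct_card)
  fix i assume i: "i < length xs"
  then obtain j where j: "j < length ys" "ys ! j = xs ! i"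
    using s by (metis in_set_conv_nth)
  then have "lab_of ys (xs ! i) = Some (Suc j)" using lab_of_nth[OF assms(2) j(1)] by simp
  then show "xs ! i = ys ! i" using lab_of_nth[OF assms(1) i] assms(3) j by simp
qed

abbreviation edge_rel :: "'a set set \<Rightarrow> 'a \<Rightarrow> 'a \<Rightarrow> bool" where
  "edge_rel E u v \<equiv> {u, v} \<in> E"

text \<open>This is the invariant of the process: a step to an old vertex keeps the list, a step to
  a new vertex appends it. Since the current vertex is in the list, the appended vertex has an
  earlier neighbour.\<close>

lemma walk_state_lab_of:
  assumes "walk_state V E v i lab"
  shows "\<exists>x xs. distinct (x # xs) \<and> set (x # xs) \<subseteq> V \<and> grows (edge_rel E) {x} xs \<and>
    lab = lab_of (x # xs) \<and> i = length (x # xs) \<and> v \<in> set (x # xs)"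
  using assms
proof induction
  case (start v)
  then show ?case
    by (intro exI[of _ v] exI[of _ "[]"]) (auto simp: lab_of_def)
next
  case (visit_new v i lab w)
  then obtain x xs where *: "distinct (x # xs)" "set (x # xs) \<subseteq> V" "grows (edge_rel E) {x} xs"
    "lab = lab_of (x # xs)" "i = length (x # xs)" "v \<in> set (x # xs)" by blast
  have "w \<notin> set (x # xs)" using visit_new.hyps * by (metis domIff dom_lab_of)
  then have "lab_of (x # xs @ [w]) = lab(w \<mapsto> i + 1)"
    using lab_of_snoc[of w "x # xs"] * by simp
  then show ?case
    using * visit_new.hyps \<open>w \<notin> _\<close>
    by (intro exI[of _ x] exI[of _ "xs @ [w]"]) (auto simp: grows_snoc)
next
  case (visit_old v i lab w)
  then obtain x xs where *: "distinct (x # xs)" "set (x # xs) \<subseteq> V" "grows (edge_rel E) {x} xs"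
    "lab = lab_of (x # xs)" "i = length (x # xs)" by blast
  moreover have "w \<in> set (x # xs)" using visit_old.hyps * by (metis domIff dom_lab_of)
  ultimately show ?case by blast
qed

text \<open>Moves within the labeled set change neither counter nor labeling. The process stops once
  all vertices are labeled, hence the strict inclusion.\<close>

lemma walk_state_rtrancl:
  assumes "(v, u) \<in> {(a, b). {a, b} \<in> E \<and> b \<in> dom lab}\<^sup>*" "walk_state V E v i lab" "dom lab \<subset> V"
  shows "walk_state V E u i lab"
  using assms
proof (induction rule: rtrancl_induct)
  case base
  then show ?case by simp
next
  case (step y z)
  then show ?case
    by (intro walk_state.visit_old[of V E y i lab z]) (blast | fastforce)+
qed

text \<open>The last vertex \<open>y\<close> is joined to an earlier vertex \<open>w\<close>, so all
  connections can be routed through \<open>w\<close>.\<close>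

lemma grows_connected:
  assumes "grows (edge_rel E) {x} xs" "u \<in> set (x # xs)" "v \<in> set (x # xs)"
  shows "(u, v) \<in> {(a, b). {a, b} \<in> E \<and> a \<in> set (x # xs) \<and> b \<in> set (x # xs)}\<^sup>*"
  using assms
proof (induction xs arbitrary: u v rule: rev_induct)
  case Nil
  then show ?case by simp
next
  case (snoc y ys)
  define C where "C = (\<lambda>zs. {(a, b). {a, b} \<in> E \<and> a \<in> set (x # zs) \<and> b \<in> set (x # zs)})"
  have mono: "(C ys)\<^sup>* \<subseteq> (C (ys @ [y]))\<^sup>*"
    by (rule rtrancl_mono) (auto simp: C_def)
  from snoc.prems(1) obtain w where w: "w \<in> set (x # ys)" "{w, y} \<in> E" and g: "grows (edge_rel E) {x} ys"
    by (auto simp: grows_snoc)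
  then have e: "(w, y) \<in> C (ys @ [y])" "(y, w) \<in> C (ys @ [y])"
    by (auto simp: C_def insert_commute)
  have old: "(a, b) \<in> (C (ys @ [y]))\<^sup>*" if "a \<in> set (x # ys)" "b \<in> set (x # ys)" for a b
    using snoc.IH[OF g that] mono by (auto simp: C_def)
  have 1: "(u, w) \<in> (C (ys @ [y]))\<^sup>*"
    using snoc.prems(2) old[OF _ w(1)] e by (cases "u = y") (auto intro: r_into_rtrancl)
  have 2: "(w, v) \<in> (C (ys @ [y]))\<^sup>*"
    using snoc.prems(3) old[OF w(1)] e by (cases "v = y") (auto intro: r_into_rtrancl)
  from 1 2 have "(u, v) \<in> (C (ys @ [y]))\<^sup>*" by (rule rtrancl_trans)
  then show ?case by (simp add: C_def)
qed

text \<open>Between two new labels the walk goes from the last labeled vertex through labeled ones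
  to a neighbour \<open>w\<close> of the next vertex \<open>y\<close>.\<close>

lemma grows_walk_state:
  assumes "grows (edge_rel E) {x} xs" "distinct (x # xs)" "set (x # xs) \<subseteq> V"
  shows "walk_state V E (last (x # xs)) (length (x # xs)) (lab_of (x # xs))"
  using assms
proof (induction xs rule: rev_induct)
  case Nil
  then have "walk_state V E x 1 (lab_of [x])"
    unfolding lab_of_singleton by (intro walk_state.start) simp
  then show ?case by simp
next
  case (snoc y ys)
  from snoc.prems(1) obtain w where w: "w \<in> set (x # ys)" "{w, y} \<in> E" and g: "grows (edge_rel E) {x} ys"
    by (auto simp: grows_snoc)
  let ?l = "lab_of (x # ys)"
  have "walk_state V E (last (x # ys)) (length (x # ys)) ?l"
    using snoc g by auto
  moreover have "(last (x # ys), w) \<in> {(a, b). {a, b} \<in> E \<and> b \<in> dom ?l}\<^sup>*"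
    using grows_connected[OF g last_in_set w(1)]
    by (rule rtrancl_mono[THEN subsetD, rotated]) auto
  moreover have "dom ?l \<subset> V"
    using snoc.prems by auto
  ultimately have "walk_state V E w (length (x # ys)) ?l"
    by (blast intro: walk_state_rtrancl)
  moreover have y: "y \<notin> set (x # ys)" using snoc.prems by auto
  ultimately have "walk_state V E y (length (x # ys) + 1) (?l(y \<mapsto> length (x # ys) + 1))"
  proof (intro walk_state.visit_new[of V E w])
    show "?l y = None" using y dom_lab_of by (metis domIff)
  qed (use snoc.prems w \<open>dom ?l \<subset> V\<close> in auto)
  then show ?case
    using lab_of_snoc[OF y] by (simp del: fun_upd_apply)
qed

lemma random_walk_labelings_eq:
  "random_walk_labelings V E = (\<Union>x\<in>V. (\<lambda>xs. lab_of (x # xs)) ` growths (edge_rel E) {x} (V - {x}))"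
  (is "_ = ?U")
proof (intro set_eqI iffI)
  fix lab assume "lab \<in> random_walk_labelings V E"
  then obtain v i where "walk_state V E v i lab" and d: "dom lab = V"
    by (auto simp: random_walk_labelings_def)
  from walk_state_lab_of[OF this(1)] obtain x xs where *: "distinct (x # xs)"
    "grows (edge_rel E) {x} xs" "lab = lab_of (x # xs)" by blast
  then have "set (x # xs) = V" using d by (metis dom_lab_of)
  then show "lab \<in> ?U"
    using * by (auto simp: growths_def)
next
  fix lab assume "lab \<in> ?U"
  then obtain x xs where *: "x \<in> V" "xs \<in> growths (edge_rel E) {x} (V - {x})" "lab = lab_of (x # xs)"
    by auto
  then have "walk_state V E (last (x # xs)) (length (x # xs)) lab"
    using grows_walk_state[of E x xs V] by (auto simp: growths_def)
  moreover have "dom lab = V" using * by (auto simp: growths_def)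
  ultimately show "lab \<in> random_walk_labelings V E"
    by (auto simp: random_walk_labelings_def)
qed

lemma lab_of_Cons_growths:
  assumes "xs \<in> growths R {x} (V - {x})" "ys \<in> growths R {y} (V - {y})" "lab_of (x # xs) = lab_of (y # ys)"
  shows "x = y \<and> xs = ys"
  using lab_of_inj[of "x # xs" "y # ys"] assms by (auto simp: growths_def)

text \<open>Label \<open>1\<close> sits at the head of the list, so only the lists with head
  \<open>v\<close> contribute.\<close>

lemma num_labelings_from_eq:
  assumes "v \<in> V"
  shows "num_labelings_from V E v = num_growths (edge_rel E) {v} (V - {v})"
proof -
  have 1: "lab_of (x # xs) v = Some 1 \<longleftrightarrow> x = v" if "xs \<in> growths (edge_rel E) {x} (V - {x})" for x xs
  proof -
    have d: "distinct (x # xs)" and s: "set (x # xs) = insert x V" using that by (auto simp: growths_def)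
    obtain i where i: "i < length (x # xs)" "(x # xs) ! i = v"
      using s assms by (metis insertI2 in_set_conv_nth)
    then have l: "lab_of (x # xs) v = Some (Suc i)" using lab_of_nth[OF d i(1)] by simp
    have "x = v \<longleftrightarrow> i = 0"
      using nth_eq_iff_index_eq[OF d, of 0 i] i by auto
    then show ?thesis using l by simp
  qed
  have "{lab \<in> random_walk_labelings V E. lab v = Some 1} =
      (\<lambda>xs. lab_of (v # xs)) ` growths (edge_rel E) {v} (V - {v})"
    unfolding random_walk_labelings_eq using assms 1 by auto
  moreover have "inj_on (\<lambda>xs. lab_of (v # xs)) (growths (edge_rel E) {v} (V - {v}))"
    using lab_of_Cons_growths by (fastforce simp: inj_on_def)
  ultimately show ?thesis
    by (simp add: num_labelings_from_def num_growths_def card_image)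
qed

lemma num_labelings_eq:
  fixes V :: "'a set"
  assumes "finite V"
  shows "num_labelings V E = (\<Sum>v\<in>V. num_growths (edge_rel E) {v} (V - {v}))"
proof -
  have "num_labelings V E = (\<Sum>x\<in>V. card ((\<lambda>xs. lab_of (x # xs)) ` growths (edge_rel E) {x} (V - {x})))"
    unfolding num_labelings_def random_walk_labelings_eq
  proof (intro card_UN_disjoint ballI impI)
    fix x y :: 'a assume "x \<noteq> y"
    then show "(\<lambda>xs. lab_of (x # xs)) ` growths (edge_rel E) {x} (V - {x}) \<inter>
        (\<lambda>xs. lab_of (y # xs)) ` growths (edge_rel E) {y} (V - {y}) = {}"
      using lab_of_Cons_growths by fastforce
  qed (use assms in \<open>auto intro: finite_growths\<close>)
  moreover have "inj_on (\<lambda>xs. lab_of (x # xs)) (growths (edge_rel E) {x} (V - {x}))" for x :: 'a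
    using lab_of_Cons_growths by (fastforce simp: inj_on_def)
  ultimately show ?thesis
    by (simp add: num_growths_def card_image)
qed

subsection \<open>Chains of cycles as integer intervals\<close>

text \<open>
  With \<open>t = m - 1\<close>, the integer \<open>k * t + p\<close> stands for the \<open>p\<close>-th vertex of the \<open>k\<close>-th cycle, so multiples of
  \<open>t\<close> are the path vertices, and the reflection of the chain is \<open>x \<mapsto> c - x\<close>.
\<close>

definition chain_adj :: "nat \<Rightarrow> int \<Rightarrow> int \<Rightarrow> bool" where
  "chain_adj t x y \<longleftrightarrow> \<bar>x - y\<bar> = 1 \<or> (int t dvd x \<and> int t dvd y \<and> \<bar>x - y\<bar> = int t)"

lemma chain_adj_reflect:
  assumes "int t dvd c"
  shows "chain_adj t (c - x) (c - y) \<longleftrightarrow> chain_adj t x y"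
proof -
  have "int t dvd c - z \<longleftrightarrow> int t dvd z" for z
    using assms by (metis dvd_diff_right_iff dvd_diff_left_iff)
  moreover have "\<bar>c - x - (c - y)\<bar> = \<bar>x - y\<bar>" by simp
  ultimately show ?thesis by (simp only: chain_adj_def)
qed

lemma multiple_between:
  fixes c x :: int
  assumes "int t dvd c" "int t dvd x" "c < x"
  shows "c + int t \<le> x"
proof -
  have "int t dvd x - c" using assms by (intro dvd_diff)
  then have "int t \<le> x - c" using assms(3) by (intro zdvd_imp_le) simp_all
  then show ?thesis by simp
qed

text \<open>A path vertex is a cut vertex: multiples of \<open>t\<close> on different sides of
  \<open>c\<close> are at least \<open>2 * t\<close> apart, too far for a closing edge.\<close>

lemma not_chain_adj_across:
  assumes "int t dvd c" "x < c" "c < y"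
  shows "\<not> chain_adj t x y \<and> \<not> chain_adj t y x"
  using multiple_between[of t x c] multiple_between[of t c y] assms by (auto simp: chain_adj_def)

text \<open>The closing edge joins two path vertices, so an inner vertex has only its two neighbours
  along the cycle.\<close>

lemma chain_adj_interior:
  assumes "int t dvd c" "c < y" "y < c + int t"
  shows "chain_adj t x y \<longleftrightarrow> \<bar>x - y\<bar> = 1"
  using multiple_between[of t c y] assms by (auto simp: chain_adj_def)

section \<open>Gaps and one-sided chains\<close>

lemma num_growths_reflect:
  assumes "int t dvd c" "finite A"
  shows "num_growths (chain_adj t) ((\<lambda>x. c - x) ` S) ((\<lambda>x. c - x) ` A) = num_growths (chain_adj t) S A"
  using assms by (intro num_growths_image) (auto simp: chain_adj_reflect inj_on_def)

text \<open>Inside one cycle a gap can only shrink at its two ends, so there are two choices until a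
  single vertex is left.\<close>

lemma num_growths_gap:
  assumes "int t dvd c" "c \<le> p" "p < q" "q \<le> c + int t" "p \<in> S" "q \<in> S" "S \<inter> {p<..<q} = {}"
  shows "num_growths (chain_adj t) S {p<..<q} = 2 ^ (nat (q - p) - 2)"
  using assms
proof (induction "nat (q - p)" arbitrary: p q S rule: less_induct)
  case less
  have W: "{w. w \<in> {p<..<q} \<and> (\<exists>u\<in>S. chain_adj t u w)} = {p<..<q} \<inter> {p + 1, q - 1}"
  proof (intro set_eqI iffI)
    fix w assume "w \<in> {w. w \<in> {p<..<q} \<and> (\<exists>u\<in>S. chain_adj t u w)}"
    then obtain u where u: "w \<in> {p<..<q}" "u \<in> S" "chain_adj t u w" by auto
    then have "\<bar>u - w\<bar> = 1" using less.prems chain_adj_interior[of t c w u] by auto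
    moreover have "u \<notin> {p<..<q}" using u less.prems by auto
    ultimately show "w \<in> {p<..<q} \<inter> {p + 1, q - 1}" using u by auto
  next
    fix w assume "w \<in> {p<..<q} \<inter> {p + 1, q - 1}"
    moreover have "chain_adj t p (p + 1)" "chain_adj t q (q - 1)" by (auto simp: chain_adj_def)
    ultimately show "w \<in> {w. w \<in> {p<..<q} \<and> (\<exists>u\<in>S. chain_adj t u w)}"
      using less.prems by auto
  qed
  \<comment> \<open>Short gaps are separate: with one vertex the two ends coincide, and for the
    empty gap the truncated exponent \<open>1 - 2\<close> is \<open>0\<close>.\<close>
  consider "q = p + 1" | "q = p + 2" | "q \<ge> p + 3" using less.prems by linarith
  then show ?case
  proof cases
    case 1
    then have "{p<..<q} = {}" by auto
    then show ?thesis using 1 by simp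
  next
    case 2
    then have "{p<..<q} = {p + 1}" by auto
    then show ?thesis using num_growths_rec[of "{p<..<q}" "chain_adj t" S] W 2 by simp
  next
    case 3
    let ?N = "\<lambda>w. num_growths (chain_adj t) (insert w S) ({p<..<q} - {w})"
    have "p + 1 \<in> {p<..<q}" using 3 by simp
    then have ne: "{p<..<q} \<noteq> {}" by blast
    have ends: "{p<..<q} \<inter> {p + 1, q - 1} = {p + 1, q - 1}" "p + 1 \<noteq> q - 1" using 3 by auto
    have rec: "num_growths (chain_adj t) S {p<..<q} = sum ?N {p + 1, q - 1}"
      using num_growths_rec[OF finite_greaterThanLessThan_int ne, of "chain_adj t" S]
      unfolding W ends(1) .
    have "{p<..<q} - {p + 1} = {p + 1<..<q}" by auto
    moreover have "num_growths (chain_adj t) (insert (p + 1) S) {p + 1<..<q} = 2 ^ (nat (q - (p + 1)) - 2)"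
      using less.prems 3 by (intro less.hyps) auto
    moreover have "{p<..<q} - {q - 1} = {p<..<q - 1}" by auto
    moreover have "num_growths (chain_adj t) (insert (q - 1) S) {p<..<q - 1} = 2 ^ (nat (q - 1 - p) - 2)"
      using less.prems 3 by (intro less.hyps) auto
    moreover have "nat (q - (p + 1)) - 2 = nat (q - p) - 3" "nat (q - 1 - p) - 2 = nat (q - p) - 3"
      by auto
    moreover have "nat (q - p) - 2 = Suc (nat (q - p) - 3)" using 3 by linarith
    ultimately show ?thesis using rec ends(2) by simp
  qed
qed

text \<open>
  A gap of \<open>g\<close> vertices with labeled neighbours on both sides, whose last vertex carries a chain with
  \<open>c\<close> further vertices: the summand for \<open>h\<close> counts the orders in which that last vertex is labeled when
  exactly \<open>h\<close> other vertices of the gap are left, the leading \<open>1\<close> those in which it is labeled last.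
\<close>

definition gap_weight :: "nat \<Rightarrow> nat \<Rightarrow> nat" where
  "gap_weight c g = 1 + (\<Sum>h = 1..<g. (h + c choose h) * 2 ^ (h - 1))"

text \<open>The number of completions from an end of a chain of \<open>M\<close> cycles. The cycle
  split off is the one next to the start: its \<open>t\<close> unlabeled vertices form a gap whose
  last vertex carries the other cycles.\<close>

primrec chain_count :: "nat \<Rightarrow> nat \<Rightarrow> nat" where
  "chain_count t 0 = 1"
| "chain_count t (Suc M) = chain_count t M * gap_weight (M * t) t"

text \<open>The arc either grows to \<open>p + 1\<close>, which shortens the gap, or the closing
  edge from \<open>c\<close> labels \<open>c + int t\<close>, after which gap and following chain
  are independent. The count for that chain is a hypothesis, so that the induction over the number
  of cycles can supply it.\<close>

lemma num_growths_tail: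
  assumes "2 \<le> t" "int t dvd c" "c \<le> p" "p < c + int t" "p \<in> S" "c \<in> S" "S \<subseteq> {..p}"
    and next_chain: "\<And>S. c + int t \<in> S \<Longrightarrow> S \<subseteq> {..c + int t} \<Longrightarrow>
      num_growths (chain_adj t) S {c + int t<..c + int t + int (M * t)} = chain_count t M"
  shows "num_growths (chain_adj t) S {p<..c + int t + int (M * t)} =
    chain_count t M * gap_weight (M * t) (nat (c + int t - p))"
  using assms(3-7)
proof (induction "nat (c + int t - p)" arbitrary: p S rule: less_induct)
  case less
  define d e where "d = c + int t" and "e = d + int (M * t)"
  have d: "int t dvd d" using assms by (simp add: d_def)
  have de: "d \<le> e" by (simp add: e_def)
  let ?A = "{p<..e}"
  have W: "{w. w \<in> ?A \<and> (\<exists>u\<in>S. chain_adj t u w)} = {p + 1, d}"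
  proof (intro set_eqI iffI)
    fix w assume "w \<in> {w. w \<in> ?A \<and> (\<exists>u\<in>S. chain_adj t u w)}"
    then obtain u where u: "w \<in> ?A" "u \<in> S" "chain_adj t u w" by auto
    then have up: "u \<le> p" "p < w" using less.prems by auto
    show "w \<in> {p + 1, d}"
    proof (cases "\<bar>u - w\<bar> = 1")
      case True
      then show ?thesis using up by auto
    next
      case False
      \<comment> \<open>The edge is then a closing edge. It starts at or below \<open>p\<close>,
        hence before the next path vertex, and ends above \<open>p\<close>, hence not before
        \<open>d\<close>; only the edge from \<open>c\<close> to \<open>d\<close> is left.\<close>
      then have m: "int t dvd u" "int t dvd w" "w = u + int t" using u(3) up by (auto simp: chain_adj_def)
      have "\<not> c < u" using multiple_between[of t c u] assms(2) m up less.prems by auto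
      moreover have "c + int t \<le> w" using multiple_between[of t c w] assms(2) m up less.prems by auto
      ultimately show ?thesis using m by (auto simp: d_def)
    qed
  next
    fix w assume "w \<in> {p + 1, d}"
    moreover have "chain_adj t p (p + 1)" by (auto simp: chain_adj_def)
    moreover have "chain_adj t c d" using assms(2) d by (auto simp: chain_adj_def d_def)
    ultimately show "w \<in> {w. w \<in> ?A \<and> (\<exists>u\<in>S. chain_adj t u w)}"
      using less.prems de by (auto simp: d_def)
  qed
  let ?N = "\<lambda>w. num_growths (chain_adj t) (insert w S) (?A - {w})"
  have rec: "num_growths (chain_adj t) S ?A = sum ?N {p + 1, d}"
  proof -
    have "p + 1 \<in> ?A" using less.prems de by (simp add: d_def)
    then have ne: "?A \<noteq> {}" by blast
    show ?thesis
      using num_growths_rec[OF finite_greaterThanAtMost_int ne, of "chain_adj t" S] unfolding W .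
  qed
  have nc: "num_growths (chain_adj t) (insert d S) {d<..e} = chain_count t M"
    unfolding d_def e_def using less.prems by (intro next_chain) auto
  have "num_growths (chain_adj t) S ?A = chain_count t M * gap_weight (M * t) (nat (d - p))"
  \<comment> \<open>If only \<open>d\<close> is left in the gap, the two candidates coincide and the
    weight is its leading \<open>1\<close>.\<close>
  proof (cases "p + 1 = d")
    case True
    then have "?A - {d} = {d<..e}" by auto
    moreover have "nat (d - p) = 1" using True by simp
    ultimately show ?thesis using rec nc True by (simp add: gap_weight_def)
  next
    case False
    define g where "g = nat (d - (p + 1))"
    have pd: "p + 1 < d" using False less.prems by (simp add: d_def)
    have g: "nat (d - p) = Suc g" "g \<ge> 1" using pd by (auto simp: g_def)
    have "?A - {p + 1} = {p + 1<..e}" by auto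
    then have 1: "?N (p + 1) = chain_count t M * gap_weight (M * t) g"
      unfolding g_def d_def e_def
      using less.prems pd by (simp only:) (intro less.hyps; auto simp: d_def)
    have "?A - {d} = {p<..<d} \<union> {d<..e}" using pd de by auto
    moreover have "num_growths (chain_adj t) (insert d S) ({p<..<d} \<union> {d<..e}) =
        (card {p<..<d} + card {d<..e} choose card {p<..<d}) *
        num_growths (chain_adj t) (insert d S) {p<..<d} * num_growths (chain_adj t) (insert d S) {d<..e}"
      using not_chain_adj_across[OF d] by (intro num_growths_Un) auto
    moreover have "card {p<..<d} = g" by (simp add: g_def)
    moreover have "card {d<..e} = M * t" by (simp add: e_def nat_mult_distrib)
    moreover have "num_growths (chain_adj t) (insert d S) {p<..<d} = 2 ^ (nat (d - p) - 2)"
      using less.prems pd assms(2) by (intro num_growths_gap[of t c]) (auto simp: d_def)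
    moreover have "nat (d - p) - 2 = g - 1" using g by simp
    ultimately have 2: "?N d = (g + M * t choose g) * 2 ^ (g - 1) * chain_count t M"
      using nc by simp
    \<comment> \<open>Labeling \<open>d\<close> while \<open>g\<close> gap vertices are left is the
      top summand \<open>h = g\<close> of the weight; the smaller weight covers the rest.\<close>
    have "{1..<Suc g} = insert g {1..<g}" using g by auto
    then have "gap_weight (M * t) (Suc g) = gap_weight (M * t) g + (g + M * t choose g) * 2 ^ (g - 1)"
      by (simp add: gap_weight_def)
    then show ?thesis
      using rec 1 2 False by (simp add: g algebra_simps)
  qed
  then show ?case by (simp only: d_def e_def)
qed

text \<open>This is the tail with \<open>p = c\<close>, a gap of \<open>t\<close> vertices; the
  induction hypothesis at the next path vertex provides \<open>next_chain\<close>.\<close>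

lemma num_growths_chain_right:
  assumes "2 \<le> t" "int t dvd c" "c \<in> S" "S \<subseteq> {..c}"
  shows "num_growths (chain_adj t) S {c<..c + int (M * t)} = chain_count t M"
  using assms(2-4)
proof (induction M arbitrary: c S)
  case 0
  then show ?case by simp
next
  case (Suc M)
  have "num_growths (chain_adj t) S {c<..c + int t + int (M * t)} =
    chain_count t M * gap_weight (M * t) (nat (c + int t - c))"
    using Suc assms(1) by (intro num_growths_tail) auto
  then show ?case by (simp add: algebra_simps)
qed

lemma num_growths_tail_right:
  assumes "2 \<le> t" "int t dvd c" "c \<le> p" "p < c + int t"
  shows "num_growths (chain_adj t) {c..p} {p<..c + int t + int (M * t)} =
    chain_count t M * gap_weight (M * t) (nat (c + int t - p))"
proof (rule num_growths_tail[OF assms])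
  fix S assume "c + int t \<in> S" "S \<subseteq> {..c + int t}"
  then show "num_growths (chain_adj t) S {c + int t<..c + int t + int (M * t)} = chain_count t M"
    using assms by (intro num_growths_chain_right) simp_all
qed (use assms in auto)

lemma reflect_interval:
  "(\<lambda>x::int. c - x) ` {a<..b} = {c - b..<c - a}" "(\<lambda>x::int. c - x) ` {a..b} = {c - b..c - a}"
proof -
  show "(\<lambda>x::int. c - x) ` {a<..b} = {c - b..<c - a}"
    by (auto intro!: image_eqI[where x = "c - x" for x])
  show "(\<lambda>x::int. c - x) ` {a..b} = {c - b..c - a}"
    by (auto intro!: image_eqI[where x = "c - x" for x])
qed

text \<open>The reflection \<open>2 * c - x\<close> fixes \<open>c\<close> and turns the left chain
  into a right one.\<close>

lemma num_growths_chain_left: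
  assumes "2 \<le> t" "int t dvd c" "c \<in> S" "S \<subseteq> {c..}"
  shows "num_growths (chain_adj t) S {c - int (M * t)..<c} = chain_count t M"
proof -
  have "num_growths (chain_adj t) ((\<lambda>x. 2 * c - x) ` S) {c<..c + int (M * t)} = chain_count t M"
    using assms by (intro num_growths_chain_right) (auto intro: image_eqI[of _ _ c])
  then show ?thesis
    using num_growths_reflect[of t "2 * c" "{c<..c + int (M * t)}" "(\<lambda>x. 2 * c - x) ` S"] assms(2)
    by (simp add: reflect_interval image_image)
qed

lemma num_growths_tail_left:
  assumes "2 \<le> t" "int t dvd c" "c < p" "p \<le> c + int t"
  shows "num_growths (chain_adj t) {p..c + int t} {c - int (M * t)..<p} =
    chain_count t M * gap_weight (M * t) (nat (p - c))"
proof -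
  \<comment> \<open>Reflection with \<open>d\<close> exchanges \<open>c\<close> and
    \<open>c + int t\<close>, so the arc \<open>{p..c + int t}\<close> becomes
    \<open>{c..p'}\<close>.\<close>
  define d p' where "d = 2 * c + int t" and "p' = d - p"
  have d: "int t dvd d" using assms(2) by (simp add: d_def)
  have "num_growths (chain_adj t) {c..p'} {p'<..c + int t + int (M * t)} =
      chain_count t M * gap_weight (M * t) (nat (c + int t - p'))"
    using assms by (intro num_growths_tail_right) (simp_all add: d_def p'_def)
  moreover have "{d - p'..d - c} = {p..c + int t}"
    "{d - (c + int t + int (M * t))..<d - p'} = {c - int (M * t)..<p}" "c + int t - p' = p - c"
    by (simp_all add: d_def p'_def)
  ultimately show ?thesis
    using num_growths_reflect[OF d, of "{p'<..c + int t + int (M * t)}" "{c..p'}"]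
    unfolding reflect_interval by (simp only: finite_greaterThanAtMost_int)
qed

section \<open>Starting at a path vertex\<close>

lemma num_growths_from_multiple:
  assumes "2 \<le> t" "k \<le> n"
  shows "num_growths (chain_adj t) {int (k * t)} ({0..int (n * t)} - {int (k * t)}) =
    (n * t choose (k * t)) * chain_count t k * chain_count t (n - k)"
proof -
  obtain l where n: "n = k + l" using assms(2) le_Suc_ex by blast
  let ?c = "int (k * t)"
  have "{0..int (n * t)} - {?c} = {?c - int (k * t)..<?c} \<union> {?c<..?c + int (l * t)}"
  proof -
    have "0 \<le> ?c" "0 \<le> int (l * t)" by simp_all
    moreover have "int (n * t) = ?c + int (l * t)" by (simp add: n algebra_simps)
    ultimately show ?thesis by (auto simp del: of_nat_mult)
  qed
  moreover have "num_growths (chain_adj t) {?c} ({?c - int (k * t)..<?c} \<union> {?c<..?c + int (l * t)}) =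
      (card {?c - int (k * t)..<?c} + card {?c<..?c + int (l * t)} choose card {?c - int (k * t)..<?c}) *
      num_growths (chain_adj t) {?c} {?c - int (k * t)..<?c} *
      num_growths (chain_adj t) {?c} {?c<..?c + int (l * t)}"
    using not_chain_adj_across[of t ?c] by (intro num_growths_Un) auto
  moreover have "num_growths (chain_adj t) {?c} {?c - int (k * t)..<?c} = chain_count t k"
    using assms by (intro num_growths_chain_left) simp_all
  moreover have "num_growths (chain_adj t) {?c} {?c<..?c + int (l * t)} = chain_count t l"
    using assms by (intro num_growths_chain_right) simp_all
  moreover have "card {?c - int (k * t)..<?c} = k * t" "card {?c<..?c + int (l * t)} = l * t"
    by (simp_all add: nat_mult_distrib)
  ultimately show ?thesis
    by (simp only:) (simp add: n algebra_simps)
qed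

section \<open>Starting at an inner vertex of a cycle\<close>

text \<open>
  \<open>X i j\<close> is the number of completions of the labeled arc from \<open>i\<close> to \<open>j\<close>. An arc of \<open>d + 1\<close> vertices
  arises from two arcs of \<open>d\<close> vertices, which gives the powers of \<open>2\<close>.
\<close>

lemma arc_recursion_sum:
  fixes X :: "nat \<Rightarrow> nat \<Rightarrow> nat"
  assumes "\<And>i j. 1 \<le> i \<Longrightarrow> i \<le> j \<Longrightarrow> j < t \<Longrightarrow> X i j = X (i - 1) j + X i (j + 1)"
    and "1 \<le> d" "d \<le> t"
  shows "(\<Sum>i = 1..t - d. X i (i + d - 1)) = (\<Sum>q = d..<t. 2 ^ (q - d) * (X 0 q + X (t - q) t))"
  using assms(3,2)
\<comment> \<open>The induction descends from \<open>d = t\<close>, where both sums are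
  empty.\<close>
proof (induction d rule: inc_induct)
  case base
  then show ?case by simp
next
  case (step d)
  obtain l where l: "t - d = Suc l" "t - Suc d = l" "t = d + Suc l"
    using step.hyps by (metis Suc_diff_Suc add_diff_inverse_nat diff_Suc_Suc less_imp_not_less)
  \<comment> \<open>Summing the recursion gives the sum for arcs of \<open>d + 1\<close> inner
    vertices twice. What is left over are the arcs that have just reached a path vertex:
    \<open>X 0 d\<close> on the left and \<open>X (t - d) t\<close> on the right.\<close>
  have "(\<Sum>i = 1..Suc l. X i (i + d - 1)) = (\<Sum>i = 1..Suc l. X (i - 1) (i - 1 + d)) + (\<Sum>i = 1..Suc l. X i (i + d))"
    unfolding sum.distrib[symmetric]
  proof (rule sum.cong)
    fix i assume "i \<in> {1..Suc l}"
    then show "X i (i + d - 1) = X (i - 1) (i - 1 + d) + X i (i + d)"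
      using assms(1)[of i "i + d - 1"] step.prems l by auto
  qed simp
  also have "(\<Sum>i = 1..Suc l. X (i - 1) (i - 1 + d)) = (\<Sum>i = 0..l. X i (i + d))"
    using sum.shift_bounds_cl_Suc_ivl[of "\<lambda>i. X (i - 1) (i - 1 + d)" 0 l] by simp
  also have "\<dots> = X 0 d + (\<Sum>i = 1..l. X i (i + d))"
    by (simp add: sum.atLeast_Suc_atMost)
  also have "(\<Sum>i = 1..Suc l. X i (i + d)) = (\<Sum>i = 1..l. X i (i + d)) + X (t - d) t"
    using l by (simp add: add.commute)
  also have "(\<Sum>i = 1..l. X i (i + d)) = (\<Sum>q = Suc d..<t. 2 ^ (q - Suc d) * (X 0 q + X (t - q) t))"
    using step.IH l step.prems by simp
  finally have "(\<Sum>i = 1..t - d. X i (i + d - 1)) = X 0 d + X (t - d) t +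
      2 * (\<Sum>q = Suc d..<t. 2 ^ (q - Suc d) * (X 0 q + X (t - q) t))"
    using l by simp
  also have "2 * (\<Sum>q = Suc d..<t. 2 ^ (q - Suc d) * (X 0 q + X (t - q) t)) =
      (\<Sum>q = Suc d..<t. 2 ^ (q - d) * (X 0 q + X (t - q) t))"
    unfolding sum_distrib_left
  proof (rule sum.cong)
    fix q assume "q \<in> {Suc d..<t}"
    then have "q - d = Suc (q - Suc d)" by auto
    then show "2 * (2 ^ (q - Suc d) * (X 0 q + X (t - q) t)) = 2 ^ (q - d) * (X 0 q + X (t - q) t)"
      by (simp only: power_Suc mult.assoc)
  qed simp
  also have "X 0 d + X (t - d) t + \<dots> = (\<Sum>q = d..<t. 2 ^ (q - d) * (X 0 q + X (t - q) t))"
    using step.hyps by (simp add: sum.atLeast_Suc_lessThan)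
  finally show ?case .
qed

text \<open>
  The first path vertex reached carries a chain of \<open>k\<close> cycles; \<open>g\<close> vertices of the starting cycle are
  unlabeled, among them the other path vertex, which carries a chain of \<open>l\<close> cycles.
\<close>

definition hit_count :: "nat \<Rightarrow> nat \<Rightarrow> nat \<Rightarrow> nat \<Rightarrow> nat" where
  "hit_count t k l g =
    (k * t + g + l * t choose (k * t)) * chain_count t k * chain_count t l * gap_weight (l * t) g"

text \<open>The arc runs through inner vertices until it first reaches a path vertex. Just before,
  it has \<open>q\<close> inner vertices, labeled in one of \<open>2 ^ (q - 1)\<close> orders; the
  two terms of \<open>hit_count\<close> belong to the left and the right path vertex.\<close>

lemma num_growths_interior:
  assumes "2 \<le> t" "n = Suc (k + l)"
  shows "(\<Sum>i = 1..<t. num_growths (chain_adj t) {int (k * t) + int i} ({0..int (n * t)} - {int (k * t) + int i})) =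
    (\<Sum>q = 1..<t. 2 ^ (q - 1) * (hit_count t k l (t - q) + hit_count t l k (t - q)))"
proof -
  define c e where "c = int (k * t)" and "e = int (n * t)"
  have c0: "0 = c - int (k * t)" "0 \<le> c" and e: "e = c + int t + int (l * t)"
    using assms by (simp_all add: c_def e_def algebra_simps)
  have ce: "c + int t \<le> e" unfolding e by simp
  have dvd: "int t dvd c" "int t dvd c + int t" by (simp_all add: c_def)
  define X where "X i j = num_growths (chain_adj t) {c + int i..c + int j} ({0..e} - {c + int i..c + int j})" for i j
  have rec: "X i j = X (i - 1) j + X i (j + 1)" if ij: "1 \<le> i" "i \<le> j" "j < t" for i j
  proof -
    let ?S = "{c + int i..c + int j}"
    let ?A = "{0..e} - ?S"
    let ?a = "c + int i - 1" and ?b = "c + int j + 1"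
    have W: "{w. w \<in> ?A \<and> (\<exists>u\<in>?S. chain_adj t u w)} = {?a, ?b}"
    proof (intro set_eqI iffI)
      fix w assume "w \<in> {w. w \<in> ?A \<and> (\<exists>u\<in>?S. chain_adj t u w)}"
      then obtain u where u: "w \<in> ?A" "u \<in> ?S" "chain_adj t u w" by blast
      moreover have "chain_adj t u w = chain_adj t w u" by (auto simp: chain_adj_def)
      ultimately have "\<bar>w - u\<bar> = 1"
        using chain_adj_interior[OF dvd(1), of u w] ij by auto
      then show "w \<in> {?a, ?b}" using u by auto
    next
      fix w assume "w \<in> {?a, ?b}"
      moreover have "chain_adj t (c + int i) ?a" "chain_adj t (c + int j) ?b" by (auto simp: chain_adj_def)
      moreover have "?a \<in> ?A" "?b \<in> ?A" using ij c0(2) ce by auto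
      ultimately show "w \<in> {w. w \<in> ?A \<and> (\<exists>u\<in>?S. chain_adj t u w)}"
        using ij by auto
    qed
    have "?a \<in> ?A" using ij c0(2) ce by auto
    then have ne: "?A \<noteq> {}" by blast
    have "X i j = (\<Sum>w\<in>{?a, ?b}. num_growths (chain_adj t) (insert w ?S) (?A - {w}))"
      using num_growths_rec[OF finite_Diff[OF finite_atLeastAtMost_int] ne, of "chain_adj t" ?S]
      unfolding W X_def .
    also have "\<dots> = num_growths (chain_adj t) (insert ?a ?S) (?A - {?a}) +
        num_growths (chain_adj t) (insert ?b ?S) (?A - {?b})"
      using ij by simp
    also have "insert ?a ?S = {c + int (i - 1)..c + int j}" using ij by auto
    also have "?A - {?a} = {0..e} - {c + int (i - 1)..c + int j}" using ij by auto
    also have "insert ?b ?S = {c + int i..c + int (j + 1)}" using ij by auto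
    also have "?A - {?b} = {0..e} - {c + int i..c + int (j + 1)}" using ij by auto
    finally show ?thesis by (simp only: X_def)
  qed
  \<comment> \<open>Once \<open>c\<close> is labeled, the left chain is cut off from the rest. The
    rest is a tail with \<open>t - q\<close> unlabeled cycle vertices and the closing edge
    available.\<close>
  have left: "X 0 q = hit_count t k l (t - q)" if q: "q < t" for q
  proof -
    let ?S = "{c..c + int q}" and ?L = "{c - int (k * t)..<c}" and ?R = "{c + int q<..c + int t + int (l * t)}"
    have "{0..e} - ?S = ?L \<union> ?R"
      unfolding e c0(1)[symmetric] using c0(2) q by (auto simp del: of_nat_mult)
    then have "X 0 q = num_growths (chain_adj t) ?S (?L \<union> ?R)" by (simp add: X_def)
    also have "\<dots> = (card ?L + card ?R choose card ?L) * num_growths (chain_adj t) ?S ?L * num_growths (chain_adj t) ?S ?R"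
      using not_chain_adj_across[OF dvd(1)] by (intro num_growths_Un) auto
    also have "num_growths (chain_adj t) ?S ?L = chain_count t k"
      using assms dvd by (intro num_growths_chain_left) simp_all
    also have "num_growths (chain_adj t) ?S ?R = chain_count t l * gap_weight (l * t) (nat (c + int t - (c + int q)))"
      using assms dvd q by (intro num_growths_tail_right) simp_all
    also have "nat (c + int t - (c + int q)) = t - q" by simp
    also have "card ?L = k * t" by (simp add: nat_mult_distrib)
    also have "card ?R = (t - q) + l * t"
    proof -
      have "c + int t + int (l * t) - (c + int q) = int ((t - q) + l * t)" using q by (simp add: of_nat_diff)
      then show ?thesis by (simp only: card_greaterThanAtMost_int nat_int)
    qed
    finally show ?thesis by (simp add: hit_count_def add.assoc mult.assoc)
  qed
  have right: "X i t = hit_count t l k i" if i: "1 \<le> i" "i \<le> t" for i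
  proof -
    let ?S = "{c + int i..c + int t}" and ?L = "{c - int (k * t)..<c + int i}" and ?R = "{c + int t<..c + int t + int (l * t)}"
    have "{0..e} - ?S = ?R \<union> ?L"
      unfolding e c0(1)[symmetric] using c0(2) i by (auto simp del: of_nat_mult)
    then have "X i t = num_growths (chain_adj t) ?S (?R \<union> ?L)" by (simp add: X_def)
    also have "\<dots> = (card ?R + card ?L choose card ?R) * num_growths (chain_adj t) ?S ?R * num_growths (chain_adj t) ?S ?L"
      using not_chain_adj_across[OF dvd(2)] i by (intro num_growths_Un) auto
    also have "num_growths (chain_adj t) ?S ?R = chain_count t l"
      using assms dvd i by (intro num_growths_chain_right) simp_all
    also have "num_growths (chain_adj t) ?S ?L = chain_count t k * gap_weight (k * t) (nat (c + int i - c))"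
      using assms dvd i by (intro num_growths_tail_left) simp_all
    also have "nat (c + int i - c) = i" by simp
    also have "card ?R = l * t" by (simp add: nat_mult_distrib)
    also have "card ?L = i + k * t"
    proof -
      have "c + int i - (c - int (k * t)) = int (i + k * t)" by simp
      then show ?thesis by (simp only: card_atLeastLessThan_int nat_int)
    qed
    finally show ?thesis by (simp add: hit_count_def add.assoc mult.assoc)
  qed
  \<comment> \<open>The case \<open>d = 1\<close>: the initial arcs are single vertices.\<close>
  have "(\<Sum>i = 1..t - 1. X i (i + 1 - 1)) = (\<Sum>q = 1..<t. 2 ^ (q - 1) * (X 0 q + X (t - q) t))"
    using assms(1) by (intro arc_recursion_sum rec) simp_all
  also have "(\<Sum>i = 1..t - 1. X i (i + 1 - 1)) = (\<Sum>i = 1..<t. X i i)"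
    using assms(1) by (intro sum.cong) auto
  also have "(\<Sum>q = 1..<t. 2 ^ (q - 1) * (X 0 q + X (t - q) t)) =
      (\<Sum>q = 1..<t. 2 ^ (q - 1) * (hit_count t k l (t - q) + hit_count t l k (t - q)))"
    by (intro sum.cong) (auto simp: left right)
  finally show ?thesis
    by (simp add: X_def c_def e_def)
qed

section \<open>Summing over all starting vertices\<close>

lemma sum_int_interval_blocks:
  fixes f :: "int \<Rightarrow> nat"
  assumes "1 \<le> t"
  shows "(\<Sum>v\<in>{0..int (n * t)}. f v) =
    (\<Sum>k\<le>n. f (int (k * t))) + (\<Sum>k<n. \<Sum>i = 1..<t. f (int (k * t) + int i))"
proof (induction n)
  case 0
  then show ?case by simp
next
  case (Suc n)
  let ?c = "int (n * t)"
  have "0 \<le> ?c" "int (Suc n * t) = ?c + int t" by simp_all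
  then have "{0..int (Suc n * t)} = {0..?c} \<union> {?c<..?c + int t}" by (auto simp del: of_nat_mult)
  then have "(\<Sum>v\<in>{0..int (Suc n * t)}. f v) = (\<Sum>v\<in>{0..?c}. f v) + (\<Sum>v\<in>{?c<..?c + int t}. f v)"
    by (simp only:) (intro sum.union_disjoint; auto)
  also have "(\<Sum>v\<in>{?c<..?c + int t}. f v) = (\<Sum>i\<in>{1..t}. f (?c + int i))"
    by (rule sum.reindex_bij_witness[of _ "\<lambda>i. ?c + int i" "\<lambda>v. nat (v - ?c)"]) (auto simp del: of_nat_mult)
  also have "{1..t} = insert t {1..<t}" using assms by auto
  also have "(\<Sum>i\<in>insert t {1..<t}. f (?c + int i)) = f (int (Suc n * t)) + (\<Sum>i = 1..<t. f (?c + int i))"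
    by (simp add: add.commute)
  finally show ?case using Suc by (simp del: of_nat_mult mult_Suc)
qed

lemma num_growths_total:
  assumes "2 \<le> t"
  shows "(\<Sum>v\<in>{0..int (n * t)}. num_growths (chain_adj t) {v} ({0..int (n * t)} - {v})) =
    (\<Sum>k\<le>n. (n * t choose (k * t)) * chain_count t k * chain_count t (n - k)) +
    (\<Sum>k<n. \<Sum>q = 1..<t. 2 ^ q * hit_count t k (n - 1 - k) (t - q))"
proof -
  let ?f = "\<lambda>k. \<Sum>q = 1..<t. 2 ^ (q - 1) * hit_count t k (n - 1 - k) (t - q)"
  let ?g = "\<lambda>k. \<Sum>q = 1..<t. 2 ^ (q - 1) * hit_count t (n - 1 - k) k (t - q)"
  have "(\<Sum>v\<in>{0..int (n * t)}. num_growths (chain_adj t) {v} ({0..int (n * t)} - {v})) =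
    (\<Sum>k\<le>n. (n * t choose (k * t)) * chain_count t k * chain_count t (n - k)) + (\<Sum>k<n. ?f k + ?g k)"
  proof -
    have "(\<Sum>i = 1..<t. num_growths (chain_adj t) {int (k * t) + int i} ({0..int (n * t)} - {int (k * t) + int i})) =
        ?f k + ?g k" if "k < n" for k
      using num_growths_interior[OF assms, of n k "n - 1 - k"] that
      by (simp add: sum.distrib distrib_left)
    moreover have "num_growths (chain_adj t) {int (k * t)} ({0..int (n * t)} - {int (k * t)}) =
        (n * t choose (k * t)) * chain_count t k * chain_count t (n - k)" if "k \<le> n" for k
      using num_growths_from_multiple[OF assms that] .
    moreover have "1 \<le> t" using assms by simp
    ultimately show ?thesis
      unfolding sum_int_interval_blocks[OF \<open>1 \<le> t\<close>] by (intro arg_cong2[where f = "(+)"] sum.cong) simp_all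
  qed
  also have "(\<Sum>k<n. ?f k + ?g k) = (\<Sum>k<n. ?f k) + (\<Sum>k<n. ?g k)"
    by (rule sum.distrib)
  \<comment> \<open>Replacing \<open>k\<close> by \<open>n - 1 - k\<close> is the mirror image; it
    turns the right hits into the left ones.\<close>
  also have "(\<Sum>k<n. ?g k) = (\<Sum>k<n. ?f k)"
    by (subst sum.nat_diff_reindex[symmetric]) (auto intro!: sum.cong)
  also have "(\<Sum>k<n. ?f k) + (\<Sum>k<n. ?f k) = (\<Sum>k<n. \<Sum>q = 1..<t. 2 ^ q * hit_count t k (n - 1 - k) (t - q))"
    unfolding sum.distrib[symmetric]
  proof (intro sum.cong refl)
    fix k q assume "q \<in> {1..<t}"
    then have "(2::nat) ^ q = 2 ^ (q - 1) + 2 ^ (q - 1)" by (cases q) auto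
    then show "2 ^ (q - 1) * hit_count t k (n - 1 - k) (t - q) + 2 ^ (q - 1) * hit_count t k (n - 1 - k) (t - q) =
        2 ^ q * hit_count t k (n - 1 - k) (t - q)"
      by (simp only: distrib_right)
  qed
  finally show ?thesis .
qed

subsection \<open>Coding the vertices\<close>

text \<open>The offset \<open>1\<close> is there because position \<open>0\<close> of a cycle is its
  first path vertex.\<close>

primrec vertex_code :: "nat \<Rightarrow> vertex \<Rightarrow> int" where
  "vertex_code t (Path i) = int (i * t)"
| "vertex_code t (New i l) = int (i * t + l + 1)"

lemma vertex_code_cycle_vertices:
  assumes "1 \<le> t" "p < Suc t"
  shows "vertex_code t (cycle_vertices (Suc t) k ! p) = int (k * t + p)"
proof -
  consider "p = 0" | q where "p = Suc q" "q < t - 1" | "p = t"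
    using assms by (cases p) force+
  moreover obtain t' where "t = Suc t'" using assms by (metis Suc_le_D One_nat_def)
  ultimately show ?thesis
    using assms by cases (simp_all add: cycle_vertices_def nth_append)
qed

lemma cycle_vertices_in_S_verts: "k < n \<Longrightarrow> set (cycle_vertices (Suc t) k) \<subseteq> S_verts (Suc t) n"
  by (auto simp: cycle_vertices_def S_verts_def)

text \<open>Surjectivity is division by \<open>t\<close> with remainder; injectivity then follows by
  comparing cardinalities.\<close>

lemma bij_betw_vertex_code:
  assumes "1 \<le> t"
  shows "bij_betw (vertex_code t) (S_verts (Suc t) n) {0..int (n * t)}"
proof -
  have "vertex_code t ` S_verts (Suc t) n \<subseteq> {0..int (n * t)}"
  proof
    fix x assume "x \<in> vertex_code t ` S_verts (Suc t) n"
    then consider i where "i \<le> n" "x = int (i * t)"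
      | i l where "i < n" "l < t - 1" "x = int (i * t + l + 1)"
      by (auto simp: S_verts_def)
    then show "x \<in> {0..int (n * t)}"
    proof cases
      case 1
      then have "i * t \<le> n * t" by simp
      then show ?thesis using 1 by (simp only: atLeastAtMost_iff of_nat_le_iff of_nat_0_le_iff)
    next
      case 2
      then have "Suc i * t \<le> n * t" by (intro mult_right_mono) auto
      then have "i * t + l + 1 \<le> n * t" using 2 by simp
      then show ?thesis using 2 by (simp only: atLeastAtMost_iff of_nat_le_iff of_nat_0_le_iff)
    qed
  qed
  moreover have "{0..int (n * t)} \<subseteq> vertex_code t ` S_verts (Suc t) n"
  proof
    fix x assume x: "x \<in> {0..int (n * t)}"
    define y where "y = nat x"
    have y: "x = int y" "y \<le> n * t" using x unfolding y_def by (auto simp del: of_nat_mult)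
    define k p where "k = y div t" and "p = y mod t"
    have kp: "y = k * t + p" "p < t"
      using assms by (simp_all only: k_def p_def div_mult_mod_eq) simp
    show "x \<in> vertex_code t ` S_verts (Suc t) n"
    \<comment> \<open>The last path vertex has quotient \<open>n\<close>, but there is no cycle with
      index \<open>n\<close>.\<close>
    proof (cases "y = n * t")
      case True
      then have "x = vertex_code t (Path n)" "Path n \<in> S_verts (Suc t) n" using y by (auto simp: S_verts_def)
      then show ?thesis by blast
    next
      case False
      then have "k * t < n * t" using y kp by linarith
      then have k: "k < n" by simp
      have "x = vertex_code t (cycle_vertices (Suc t) k ! p)"
        using vertex_code_cycle_vertices[of t p k] assms kp y by simp
      moreover have "cycle_vertices (Suc t) k ! p \<in> S_verts (Suc t) n"
        using cycle_vertices_in_S_verts[OF k] nth_mem[of p "cycle_vertices (Suc t) k"] kp(2)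
          length_cycle_vertices[of "Suc t" k] assms by fastforce
      ultimately show ?thesis by blast
    qed
  qed
  ultimately have im: "vertex_code t ` S_verts (Suc t) n = {0..int (n * t)}" by blast
  have "card {0..int (n * t)} = card (S_verts (Suc t) n)"
    using card_S_verts(2)[of "Suc t" n] assms by (simp add: nat_add_distrib nat_mult_distrib del: of_nat_mult)
  then show ?thesis
    using im card_S_verts(1)[of "Suc t" n] assms by (simp add: bij_betw_def eq_card_imp_inj_on)
qed

lemma chain_adj_commute: "chain_adj t x y \<longleftrightarrow> chain_adj t y x"
  by (auto simp: chain_adj_def abs_minus_commute)

text \<open>Along a cycle the code grows by \<open>1\<close>, except at the closing edge, where it
  drops by \<open>t\<close> from one path vertex to the previous one.\<close>

lemma S_edges_iff_chain_adj:
  assumes "2 \<le> t" "u \<in> S_verts (Suc t) n" "v \<in> S_verts (Suc t) n"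
  shows "{u, v} \<in> S_edges (Suc t) n \<longleftrightarrow> chain_adj t (vertex_code t u) (vertex_code t v)"
proof
  have m: "1 \<le> t" using assms by simp
  assume "{u, v} \<in> S_edges (Suc t) n"
  then obtain k i where i: "i < Suc t" and
    e: "{u, v} = {cycle_vertices (Suc t) k ! i, cycle_vertices (Suc t) k ! (Suc i mod Suc t)}"
    using m by (auto simp: S_edges_def cycle_edges_def length_cycle_vertices)
  have "Suc i mod Suc t < Suc t" using m by simp
  then have codes: "vertex_code t (cycle_vertices (Suc t) k ! i) = int (k * t + i)"
    "vertex_code t (cycle_vertices (Suc t) k ! (Suc i mod Suc t)) = int (k * t + Suc i mod Suc t)"
    using vertex_code_cycle_vertices[OF m] i by blast+
  have "chain_adj t (vertex_code t (cycle_vertices (Suc t) k ! i)) (vertex_code t (cycle_vertices (Suc t) k ! (Suc i mod Suc t)))"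
  proof (cases "Suc i = Suc t")
    case True
    then have "i = t" "Suc i mod Suc t = 0" by auto
    then show ?thesis unfolding codes chain_adj_def by simp
  next
    case False
    then have "Suc i mod Suc t = Suc i" using i by simp
    then show ?thesis unfolding codes chain_adj_def by simp
  qed
  then show "chain_adj t (vertex_code t u) (vertex_code t v)"
    using e chain_adj_commute by (metis doubleton_eq_iff)
next
  have m: "1 \<le> t" using assms by simp
  note bij = bij_betw_vertex_code[OF m, of n]
  have inj: "x = y" if "x \<in> S_verts (Suc t) n" "y \<in> S_verts (Suc t) n" "vertex_code t x = vertex_code t y" for x y
    using bij that by (auto simp: bij_betw_def inj_on_def)
  \<comment> \<open>By symmetry the smaller code comes first; its quotient by \<open>t\<close> then
    identifies the cycle that contains the edge.\<close>
  have up: "{x, y} \<in> S_edges (Suc t) n"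
    if x: "x \<in> S_verts (Suc t) n" and y: "y \<in> S_verts (Suc t) n" and adj: "chain_adj t (vertex_code t x) (vertex_code t y)"
      and less: "vertex_code t x < vertex_code t y" for x y
  proof -
    have range: "vertex_code t x \<ge> 0" "vertex_code t y \<le> int (n * t)"
      using bij x y by (auto simp: bij_betw_def)
    define z where "z = nat (vertex_code t x)"
    define k p where "k = z div t" and "p = z mod t"
    have z: "vertex_code t x = int z" using range by (simp add: z_def)
    have kp: "z = k * t + p" "p < t"
      using m by (simp_all only: k_def p_def div_mult_mod_eq) simp
    have "int z < int (n * t)" using range less z by linarith
    then have "k * t < n * t" using kp by linarith
    then have k: "k < n" by simp
    have mem: "cycle_vertices (Suc t) k ! i \<in> S_verts (Suc t) n" if "i < Suc t" for i
      using cycle_vertices_in_S_verts[OF k, of t] nth_mem[of i "cycle_vertices (Suc t) k"] that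
        length_cycle_vertices[of "Suc t" k] m by fastforce
    show ?thesis
    proof (cases "vertex_code t y = vertex_code t x + 1")
      case True
      have xp: "x = cycle_vertices (Suc t) k ! p"
        using kp z m by (intro inj x mem) (simp_all add: vertex_code_cycle_vertices[OF m])
      moreover have "y = cycle_vertices (Suc t) k ! Suc p"
        using kp z m True by (intro inj y mem) (simp_all add: vertex_code_cycle_vertices[OF m])
      moreover have "Suc p mod Suc t = Suc p" "p < Suc t" using kp by auto
      ultimately have "{x, y} \<in> cycle_edges (cycle_vertices (Suc t) k)"
        using length_cycle_vertices[of "Suc t" k] m unfolding cycle_edges_def by auto
      then show ?thesis using k by (auto simp: S_edges_def)
    next
      case False
      then have "int t dvd int z" "vertex_code t y = int z + int t"
        using adj less z unfolding chain_adj_def by auto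
      then have "p = 0" "vertex_code t y = int z + int t" by (simp_all add: p_def)
      then have "vertex_code t x = vertex_code t (Path k)" "vertex_code t y = vertex_code t (Path (Suc k))"
        using kp z by simp_all
      moreover have "Path k \<in> S_verts (Suc t) n" "Path (Suc k) \<in> S_verts (Suc t) n"
        using k by (auto simp: S_verts_def)
      ultimately have "x = Path k" "y = Path (Suc k)" using inj x y by blast+
      then show ?thesis using path_edge_in_S_edges[OF k] by simp
    qed
  qed
  assume adj: "chain_adj t (vertex_code t u) (vertex_code t v)"
  then have "vertex_code t u \<noteq> vertex_code t v" using m by (auto simp: chain_adj_def)
  then consider "vertex_code t u < vertex_code t v" | "vertex_code t v < vertex_code t u" by linarith
  then show "{u, v} \<in> S_edges (Suc t) n"
  proof cases
    case 1
    then show ?thesis using up assms adj by simp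
  next
    case 2
    then have "{v, u} \<in> S_edges (Suc t) n" using up assms adj chain_adj_commute by blast
    then show ?thesis by (simp add: insert_commute)
  qed
qed

lemma num_growths_S:
  assumes "2 \<le> t" "v \<in> S_verts (Suc t) n"
  shows "num_growths (edge_rel (S_edges (Suc t) n)) {v} (S_verts (Suc t) n - {v}) =
    num_growths (chain_adj t) {vertex_code t v} ({0..int (n * t)} - {vertex_code t v})"
proof -
  have bij: "bij_betw (vertex_code t) (S_verts (Suc t) n) {0..int (n * t)}"
    using assms by (intro bij_betw_vertex_code) simp
  then have im: "{0..int (n * t)} - {vertex_code t v} = vertex_code t ` (S_verts (Suc t) n - {v})"
    using assms(2) by (auto simp: bij_betw_def inj_on_def)
  have "num_growths (chain_adj t) (vertex_code t ` {v}) (vertex_code t ` (S_verts (Suc t) n - {v})) =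
      num_growths (edge_rel (S_edges (Suc t) n)) {v} (S_verts (Suc t) n - {v})"
  proof (rule num_growths_image)
    show "finite (S_verts (Suc t) n - {v})" using assms card_S_verts(1)[of "Suc t" n] by simp
    show "inj_on (vertex_code t) (S_verts (Suc t) n - {v})"
      using bij by (auto simp: bij_betw_def intro: inj_on_diff)
    show "chain_adj t (vertex_code t u) (vertex_code t a) \<longleftrightarrow> {u, a} \<in> S_edges (Suc t) n"
      if "u \<in> {v} \<union> (S_verts (Suc t) n - {v})" "a \<in> S_verts (Suc t) n - {v}" for u a
      using S_edges_iff_chain_adj[of t u n a] assms that by auto
  qed
  then show ?thesis by (simp only: im image_insert image_empty)
qed

text \<open>From either end one of the two chains is empty and the binomial coefficient is
  \<open>1\<close>, so both ends give the same count.\<close>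

lemma num_labelings_from_end:
  assumes "2 \<le> t" "v \<in> path_ends n"
  shows "num_labelings_from (S_verts (Suc t) n) (S_edges (Suc t) n) v = chain_count t n"
proof -
  have v: "v \<in> S_verts (Suc t) n" and "vertex_code t v = 0 \<or> vertex_code t v = int (n * t)"
    using assms(2) by (auto simp: path_ends_def S_verts_def)
  then have eq: "num_labelings_from (S_verts (Suc t) n) (S_edges (Suc t) n) v =
      num_growths (chain_adj t) {vertex_code t v} ({0..int (n * t)} - {vertex_code t v})"
    using num_labelings_from_eq[OF v] num_growths_S[OF assms(1) v] by simp
  have t: "2 \<le> t" using assms by simp
  from num_growths_from_multiple[OF t, of 0 n] num_growths_from_multiple[OF t, of n n]
  show ?thesis unfolding eq
    using \<open>vertex_code t v = 0 \<or> _\<close> by (elim disjE) (simp_all del: of_nat_mult)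
qed

lemma num_labelings_S:
  assumes "2 \<le> t"
  shows "num_labelings (S_verts (Suc t) n) (S_edges (Suc t) n) = (\<Sum>x\<in>{0..int (n * t)}.
    num_growths (chain_adj t) {x} ({0..int (n * t)} - {x}))"
proof -
  have bij: "bij_betw (vertex_code t) (S_verts (Suc t) n) {0..int (n * t)}"
    using assms by (intro bij_betw_vertex_code) simp
  have "finite (S_verts (Suc t) n)" using assms by (intro card_S_verts(1)) simp
  then show ?thesis
    unfolding num_labelings_eq[OF \<open>finite _\<close>] sum.reindex_bij_betw[OF bij, symmetric]
    using assms by (intro sum.cong num_growths_S) simp_all
qed

subsection \<open>Closed formulas\<close>

text \<open>This compares the coefficients of \<open>x ^ a\<close> in the product of the power
  series of \<open>(1 - x) ^ -(r + 1)\<close> and \<open>(1 - x) ^ -(q + 1)\<close>. The proof is a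
  double induction with Pascal's rule.\<close>

lemma sum_choose_convolution:
  "(\<Sum>s = 0..a. (r + s choose s) * (q + (a - s) choose (a - s))) = (r + q + 1 + a choose a)"
proof (induction r arbitrary: a)
  case 0
  have "(\<Sum>s = 0..a. (0 + s choose s) * (q + (a - s) choose (a - s))) = (\<Sum>s = 0..a. (q + (a - s) choose (a - s)))"
    by simp
  also have "\<dots> = (\<Sum>s = 0..a. (q + s choose s))"
    by (rule sum.reindex_bij_witness[of _ "\<lambda>s. a - s" "\<lambda>s. a - s"]) auto
  finally show ?case
    using sum_choose_lower[of q a] by (simp add: atMost_atLeast0)
next
  case (Suc r)
  note IH = Suc.IH
  show ?case
  proof (induction a)
    case 0
    then show ?case by simp
  next
    case (Suc a)
    have "(\<Sum>s = 0..Suc a. (Suc r + s choose s) * (q + (Suc a - s) choose (Suc a - s))) =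
        (q + Suc a choose (Suc a)) + (\<Sum>s = 0..a. (Suc r + Suc s choose (Suc s)) * (q + (a - s) choose (a - s)))"
      by (simp add: sum.atLeast0_atMost_Suc_shift del: sum.cl_ivl_Suc binomial_Suc_Suc)
    also have "(\<Sum>s = 0..a. (Suc r + Suc s choose (Suc s)) * (q + (a - s) choose (a - s))) =
        (\<Sum>s = 0..a. (Suc r + s choose s) * (q + (a - s) choose (a - s))) +
        (\<Sum>s = 0..a. (r + Suc s choose (Suc s)) * (q + (a - s) choose (a - s)))"
      by (simp add: sum.distrib[symmetric] distrib_right)
    \<comment> \<open>The separated term completes the second sum to the one for \<open>r\<close>
      and \<open>Suc a\<close>, so both sums fall under an induction hypothesis.\<close>
    also have "(q + Suc a choose (Suc a)) + (\<dots>) =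
        (\<Sum>s = 0..a. (Suc r + s choose s) * (q + (a - s) choose (a - s))) +
        (\<Sum>s = 0..Suc a. (r + s choose s) * (q + (Suc a - s) choose (Suc a - s)))"
      by (simp add: sum.atLeast0_atMost_Suc_shift del: sum.cl_ivl_Suc binomial_Suc_Suc)
    also have "\<dots> = (Suc r + q + 1 + a choose a) + (r + q + 1 + Suc a choose (Suc a))"
      by (simp only: Suc.IH IH)
    finally show ?case by simp
  qed
qed

lemma multinomial_eq:
  assumes "N = a + b + c"
  shows "multinomial N a b c = (a + (b + c) choose a) * (b + c choose b)"
proof -
  have "fact (x + y) = fact x * fact y * (x + y choose x)" for x y :: nat
    using binomial_fact_lemma[of x "x + y"] by simp
  from this[of a "b + c"] this[of b c]
  have "fact N = (fact a * fact b * fact c) * ((a + (b + c) choose a) * (b + c choose b))"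
    by (simp add: assms add.assoc mult_ac)
  then show ?thesis
    unfolding multinomial_def by (metis fact_nonzero mult_eq_0_iff nonzero_mult_div_cancel_left)
qed

text \<open>The substitution \<open>j = t + 1 - h\<close> turns the weight into the claimed
  sum.\<close>

lemma chain_count_rec:
  assumes "1 \<le> t" "1 \<le> N"
  shows "chain_count t N = chain_count t (N - 1) *
    (1 + (\<Sum>j = 2..t. (N * t + 1 - j choose (Suc t - j)) * 2 ^ (t - j)))"
proof -
  obtain M where N: "N = Suc M" using assms by (cases N) auto
  have "(\<Sum>h = 1..<t. (h + M * t choose h) * 2 ^ (h - 1)) =
      (\<Sum>j = 2..t. (N * t + 1 - j choose (Suc t - j)) * 2 ^ (t - j))"
  proof (rule sum.reindex_bij_witness[of _ "\<lambda>j. Suc t - j" "\<lambda>h. Suc t - h"])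
    fix h assume h: "h \<in> {1..<t}"
    then have "N * t + 1 - (Suc t - h) = h + M * t" "Suc t - (Suc t - h) = h" "t - (Suc t - h) = h - 1"
      by (auto simp: N)
    then show "(N * t + 1 - (Suc t - h) choose (Suc t - (Suc t - h))) * 2 ^ (t - (Suc t - h)) =
        (h + M * t choose h) * 2 ^ (h - 1)" by simp
  qed auto
  then show ?thesis by (simp add: N gap_weight_def)
qed

text \<open>With no chain attached the binomials are \<open>1\<close> and the weight is
  \<open>1\<close> plus a geometric sum.\<close>

lemma chain_count_1:
  assumes "1 \<le> t"
  shows "chain_count t 1 = 2 ^ (t - 1)"
proof -
  have "gap_weight 0 (Suc g) = 2 ^ g" for g
    by (induction g) (simp_all add: gap_weight_def)
  from this[of "t - 1"] show ?thesis using assms by simp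
qed

text \<open>Summing out \<open>s\<close> leaves the same binomial coefficient \<open>C\<close> for
  every \<open>r\<close>. The \<open>r\<close>-th term then carries the summand
  \<open>h = t - j - r\<close> of the gap weight, and the second sum carries its leading
  \<open>1\<close>.\<close>

lemma hit_count_sums:
  assumes j: "2 \<le> j" "j \<le> t" and n: "n = Suc (k + l)"
  shows "(\<Sum>r<t - j. \<Sum>s = 0..k * t. (r + s choose s)
        * multinomial (n * t - s - j - r) (k * t - s) (t - j - r) (l * t)
        * 2 ^ (t - r - 2) * chain_count t k * chain_count t l)
      + 2 ^ (j - 1) * (\<Sum>s = 0..k * t. (t - j + s choose s) * ((n - 1) * t - s choose (k * t - s))
        * chain_count t k * chain_count t l)
    = 2 ^ (j - 1) * hit_count t k l (Suc t - j)"
proof -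
  define g where "g = t - j"
  have t: "t = j + g" "Suc t - j = Suc g" using j by (simp_all add: g_def)
  define B where "B = chain_count t k * chain_count t l"
  define C where "C = (k * t + Suc g + l * t choose (k * t))"
  have 1: "(\<Sum>s = 0..k * t. (r + s choose s) * multinomial (n * t - s - j - r) (k * t - s) (t - j - r) (l * t)
        * 2 ^ (t - r - 2) * chain_count t k * chain_count t l) =
      2 ^ (j - 1) * C * B * (((g - r) + l * t choose (g - r)) * 2 ^ (g - r - 1))" (is "?lhs = _")
    if r: "r < g" for r
  proof -
    \<comment> \<open>Writing \<open>g - r\<close> as \<open>Suc h\<close> removes the truncated
      subtractions from the exponents.\<close>
    define h where "h = g - r - 1"
    have h: "g - r = Suc h" "g = Suc (r + h)" using r by (simp_all add: h_def)
    have "?lhs = (\<Sum>s = 0..k * t. 2 ^ (j - 1) * B * ((g - r) + l * t choose (g - r)) * 2 ^ (g - r - 1) *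
        ((r + s choose s) * ((Suc h + l * t) + (k * t - s) choose (k * t - s))))"
    proof (rule sum.cong)
      fix s assume s: "s \<in> {0..k * t}"
      have "n * t = k * t + l * t + t" by (simp add: n algebra_simps)
      then have "n * t - s - j - r = (k * t - s) + (t - j - r) + l * t"
        using s r t by simp
      moreover have "t - j - r = Suc h" using h by (simp add: g_def)
      ultimately have "multinomial (n * t - s - j - r) (k * t - s) (t - j - r) (l * t) =
          ((k * t - s) + (Suc h + l * t) choose (k * t - s)) * (Suc h + l * t choose (Suc h))"
        by (simp add: multinomial_eq)
      moreover have "t - r - 2 = (j - 1) + h" using h t j by simp
      ultimately show "(r + s choose s) * multinomial (n * t - s - j - r) (k * t - s) (t - j - r) (l * t)
        * 2 ^ (t - r - 2) * chain_count t k * chain_count t l =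
        2 ^ (j - 1) * B * ((g - r) + l * t choose (g - r)) * 2 ^ (g - r - 1) *
        ((r + s choose s) * ((Suc h + l * t) + (k * t - s) choose (k * t - s)))"
        by (simp only: h(1) power_add B_def diff_Suc_1 add.commute mult_ac)
    qed simp
    also have "\<dots> = 2 ^ (j - 1) * B * ((g - r) + l * t choose (g - r)) * 2 ^ (g - r - 1) *
        (r + (Suc h + l * t) + 1 + k * t choose (k * t))"
      by (simp only: sum_choose_convolution sum_distrib_left[symmetric])
    \<comment> \<open>Here \<open>r\<close> cancels, which is why \<open>C\<close> can be factored
      out of the sum over \<open>r\<close>.\<close>
    also have "r + (Suc h + l * t) + 1 + k * t = k * t + Suc g + l * t" using h by simp
    finally show ?thesis by (simp only: C_def mult_ac)
  qed
  have 2: "(\<Sum>s = 0..k * t. (t - j + s choose s) * ((n - 1) * t - s choose (k * t - s))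
        * chain_count t k * chain_count t l) = C * B"
  proof -
    have "(\<Sum>s = 0..k * t. (t - j + s choose s) * ((n - 1) * t - s choose (k * t - s))
        * chain_count t k * chain_count t l) =
      (\<Sum>s = 0..k * t. (g + s choose s) * (l * t + (k * t - s) choose (k * t - s)) * B)"
    proof (rule sum.cong)
      fix s assume s: "s \<in> {0..k * t}"
      have "(n - 1) * t = k * t + l * t" by (simp add: n algebra_simps)
      then have "(n - 1) * t - s = l * t + (k * t - s)" using s by simp
      then show "(t - j + s choose s) * ((n - 1) * t - s choose (k * t - s)) * chain_count t k * chain_count t l =
          (g + s choose s) * (l * t + (k * t - s) choose (k * t - s)) * B"
        by (simp only: g_def B_def mult.assoc)
    qed simp
    also have "\<dots> = (g + l * t + 1 + k * t choose (k * t)) * B"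
      by (simp only: sum_choose_convolution sum_distrib_right[symmetric])
    also have "g + l * t + 1 + k * t = k * t + Suc g + l * t" by simp
    finally show ?thesis by (simp only: C_def)
  qed
  have 3: "(\<Sum>r<g. ((g - r) + l * t choose (g - r)) * 2 ^ (g - r - 1)) =
      (\<Sum>h = 1..<Suc g. (h + l * t choose h) * 2 ^ (h - 1))"
    by (rule sum.reindex_bij_witness[of _ "\<lambda>h. g - h" "\<lambda>r. g - r"]) auto
  have "(\<Sum>r<g. 2 ^ (j - 1) * C * B * (((g - r) + l * t choose (g - r)) * 2 ^ (g - r - 1))) + 2 ^ (j - 1) * (C * B) =
      2 ^ (j - 1) * (C * B * (1 + (\<Sum>h = 1..<Suc g. (h + l * t choose h) * 2 ^ (h - 1))))"
    unfolding sum_distrib_left[symmetric] 3 by (simp only: distrib_left mult_1_right mult.assoc add.commute)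
  moreover have "hit_count t k l (Suc t - j) =
      C * B * (1 + (\<Sum>h = 1..<Suc g. (h + l * t choose h) * 2 ^ (h - 1)))"
    unfolding hit_count_def gap_weight_def t(2) C_def B_def by (simp only: mult.assoc)
  moreover have "(\<Sum>r<t - j. \<Sum>s = 0..k * t. (r + s choose s)
        * multinomial (n * t - s - j - r) (k * t - s) (t - j - r) (l * t)
        * 2 ^ (t - r - 2) * chain_count t k * chain_count t l) =
      (\<Sum>r<g. 2 ^ (j - 1) * C * B * (((g - r) + l * t choose (g - r)) * 2 ^ (g - r - 1)))"
  proof (rule sum.cong)
    show "{..<t - j} = {..<g}" by (simp only: g_def)
  qed (rule 1, simp)
  ultimately show ?thesis by (simp only: 2)
qed

theorem theorem9:
  fixes m n t :: nat and e :: "nat \<Rightarrow> vertex" and b :: "nat \<Rightarrow> nat"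
  assumes "3 \<le> m" and "1 \<le> n" and "t = m - 1"
    and "\<And>N. e N \<in> path_ends N"
    and "\<And>N. b N = num_labelings_from (S_verts m N) (S_edges m N) (e N)"
  shows "(\<forall>N. b N =
           (if N = 0 then 1
            else if N = 1 then 2 ^ (m - 2)
            else b (N - 1) * (1 + (\<Sum>j = 2..t. ((N * t + 1 - j) choose (m - j)) * 2 ^ (t - j)))))
    \<and> num_labelings (S_verts m n) (S_edges m n) =
        (\<Sum>k<n. \<Sum>j = 2..t. \<Sum>r<t - j. \<Sum>s = 0..k * t.
            ((r + s) choose s)
            * multinomial (n * t - s - j - r) (k * t - s) (t - j - r) ((n - 1 - k) * t)
            * 2 ^ (t - r - 2) * b k * b (n - 1 - k))
      + (\<Sum>k<n. \<Sum>j = 2..t. 2 ^ (j - 1) * (\<Sum>s = 0..k * t.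
            ((t - j + s) choose s) * (((n - 1) * t - s) choose (k * t - s))
            * b k * b (n - 1 - k)))
      + (\<Sum>k = 0..n. ((n * t) choose (k * t)) * b k * b (n - k))"
proof -
  have t: "2 \<le> t" and m: "m = Suc t" using assms(1,3) by simp_all
  have b: "b N = chain_count t N" for N
    using num_labelings_from_end[OF t assms(4)] by (simp add: assms(5) m)
  have "b N = (if N = 0 then 1 else if N = 1 then 2 ^ (m - 2)
      else b (N - 1) * (1 + (\<Sum>j = 2..t. ((N * t + 1 - j) choose (m - j)) * 2 ^ (t - j))))" for N
  proof -
    consider "N = 0" | "N = 1" | "N > 1" by linarith
    then show ?thesis
    proof cases
      case 2
      then show ?thesis using chain_count_1[of t] t by (simp add: b m)
    next
      case 3
      then show ?thesis using chain_count_rec[of t N] t unfolding b m by simp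
    qed (simp add: b)
  qed
  moreover have "num_labelings (S_verts m n) (S_edges m n) =
        (\<Sum>k<n. \<Sum>j = 2..t. \<Sum>r<t - j. \<Sum>s = 0..k * t.
            ((r + s) choose s)
            * multinomial (n * t - s - j - r) (k * t - s) (t - j - r) ((n - 1 - k) * t)
            * 2 ^ (t - r - 2) * b k * b (n - 1 - k))
      + (\<Sum>k<n. \<Sum>j = 2..t. 2 ^ (j - 1) * (\<Sum>s = 0..k * t.
            ((t - j + s) choose s) * (((n - 1) * t - s) choose (k * t - s))
            * b k * b (n - 1 - k)))
      + (\<Sum>k = 0..n. ((n * t) choose (k * t)) * b k * b (n - k))" (is "_ = ?A + ?B + ?C")
  proof -
    have "?A + ?B = (\<Sum>k<n. \<Sum>j = 2..t. 2 ^ (j - 1) * hit_count t k (n - 1 - k) (Suc t - j))"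
      unfolding sum.distrib[symmetric] b
      by (intro sum.cong refl hit_count_sums) auto
    \<comment> \<open>With \<open>q = j - 1\<close> the gap size \<open>Suc t - j\<close> becomes
      \<open>t - q\<close>.\<close>
    also have "\<dots> = (\<Sum>k<n. \<Sum>q = 1..<t. 2 ^ q * hit_count t k (n - 1 - k) (t - q))"
      by (rule sum.cong[OF refl], rule sum.reindex_bij_witness[of _ Suc "\<lambda>j. j - 1"]) auto
    finally show ?thesis
      using num_labelings_S[OF t, of n] num_growths_total[OF t, of n]
      by (simp only: m b atMost_atLeast0 add.commute)
  qed
  ultimately show ?thesis by blast
qed

end
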